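(* Let $X$ be a primary Banach space with a UFDD. Then $X$ has the Schroeder-Bernstein Property.
   Context: Banach spaces are real; $X\sim Y$ means $X$ and $Y$ are isomorphic (linearly homeomorphic). A Banach space $X$ is primary if whenever $X=Y\oplus Z$, then $Y\sim X$ or $Z\sim X$. A Schauder decomposition $X=\sum_{n\in\mathbb N}E_n$ is a sequence $(E_n)_{n\in\mathbb N}$ of closed subspaces of $X$ such that every $x\in X$ can be written uniquely as $x=\sum_n x_n$ with $x_n\in E_n$ for all $n$; it is unconditional if there is a constant $C$ such that $\|\sum_{n\in I}x_n\|\le C\|x\|$ for all $x=\sum_n x_n$ and all $I\subset\mathbb N$. A UFDD is an unconditional Schauder decomposition with every $E_n$ finite-dimensional. $X$ has the Schroeder-Bernstein Property if whenever a Banach space $Y$ is isomorphic to a complemented subspace of $X$ and $X$ is isomorphic to a complemented subspace of $Y$, it follows that $Y\sim X$. *)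

theory Defs
  imports "HOL-Analysis.Analysis"
begin

text \<open>
  A real Banach space is a type of class \<^class>\<open>banach\<close>; its subspaces are sets. Properties of a
  whole space take the type as an argument, as in \<open>TYPE('a)\<close>. The relation \<open>\<simeq>\<close> is defined on
  subspaces, possibly of different spaces, so that it also compares a subspace with a whole space
  \<^const>\<open>UNIV\<close>. The linear homeomorphism need not extend to the ambient space, hence linearity
  is only required on \<open>S\<close>.
\<close>

definition isomorphic_spaces ::
    "'a::real_normed_vector set \<Rightarrow> 'b::real_normed_vector set \<Rightarrow> bool" (infix "\<simeq>" 50) where
  "S \<simeq> T \<longleftrightarrow>
    (\<exists>f g. homeomorphism S T f g \<and>
           (\<forall>x\<in>S. \<forall>y\<in>S. f (x + y) = f x + f y) \<and>
           (\<forall>c. \<forall>x\<in>S. f (c *\<^sub>R x) = c *\<^sub>R f x))"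

text \<open>Internal direct sum of closed subspaces. Boundedness of the two projections is not required:
  in a Banach space it follows from the closed graph theorem.\<close>

definition direct_sum_decomposition :: "'a::banach set \<Rightarrow> 'a set \<Rightarrow> bool" where
  "direct_sum_decomposition Y Z \<longleftrightarrow>
    subspace Y \<and> closed Y \<and> subspace Z \<and> closed Z \<and>
    (\<forall>x. \<exists>y\<in>Y. \<exists>z\<in>Z. x = y + z) \<and> Y \<inter> Z = {0}"

definition complemented_subspace :: "'a::banach set \<Rightarrow> bool" where
  "complemented_subspace Y \<longleftrightarrow> (\<exists>Z. direct_sum_decomposition Y Z)"

definition primary_space :: "'a::banach itself \<Rightarrow> bool" where
  "primary_space _ \<longleftrightarrow>
    (\<forall>Y Z :: 'a set. direct_sum_decomposition Y Z \<longrightarrow>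
       Y \<simeq> (UNIV :: 'a set) \<or> Z \<simeq> (UNIV :: 'a set))"

definition schauder_decomposition :: "(nat \<Rightarrow> 'a::banach set) \<Rightarrow> bool" where
  "schauder_decomposition E \<longleftrightarrow>
    (\<forall>n. subspace (E n) \<and> closed (E n)) \<and>
    (\<forall>x. \<exists>!xs. (\<forall>n. xs n \<in> E n) \<and> xs sums x)"

text \<open>The subseries over an arbitrary index set \<open>I\<close> is required to converge, since its sum occurs in
  the estimate.\<close>

definition unconditional_decomposition :: "(nat \<Rightarrow> 'a::banach set) \<Rightarrow> bool" where
  "unconditional_decomposition E \<longleftrightarrow>
    schauder_decomposition E \<and>
    (\<exists>C::real. \<forall>x xs I. (\<forall>n. xs n \<in> E n) \<and> xs sums x \<longrightarrow>
       (\<exists>y. (\<lambda>n. if n \<in> I then xs n else 0) sums y \<and> norm y \<le> C * norm x))"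

definition UFDD :: "(nat \<Rightarrow> 'a::banach set) \<Rightarrow> bool" where
  "UFDD E \<longleftrightarrow>
    unconditional_decomposition E \<and> (\<forall>n. \<exists>B. finite B \<and> E n = span B)"

text \<open>
  HOL cannot quantify over types inside a definition, so the competing Banach space \<open>Y\<close> is the second
  type argument. The Schroeder-Bernstein Property of \<open>'a\<close> is the assertion of this predicate for
  a type variable \<open>'b\<close>, which in a theorem is universally quantified over all Banach spaces.
\<close>

definition schroeder_bernstein_property :: "'a::banach itself \<Rightarrow> 'b::banach itself \<Rightarrow> bool" where
  "schroeder_bernstein_property _ _ \<longleftrightarrow>
    ((\<exists>V :: 'a set. complemented_subspace V \<and> (UNIV :: 'b set) \<simeq> V) \<and>
     (\<exists>W :: 'b set. complemented_subspace W \<and> (UNIV :: 'a set) \<simeq> W)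
     \<longrightarrow> (UNIV :: 'b set) \<simeq> (UNIV :: 'a set))"

end

theory Submission
  imports Defs
begin

text \<open>
  Let \<open>X\<close> be infinite-dimensional and, for \<open>I \<subseteq> \<nat>\<close>, let \<open>X\<^sub>I\<close> be the range of the projection \<open>P I\<close> onto
  the components in \<open>I\<close>. Since \<open>X\<close> is primary, the set \<open>A = {I. X\<^sub>I \<simeq> X}\<close> contains \<open>I\<close> or its complement for
  every \<open>I\<close>, and it is invariant under finite changes of \<open>I\<close>. Operators \<open>U\<close>, \<open>S\<close> on \<open>X\<close> with \<open>U S = 1\<close>
  and \<open>S U = P I\<close> witness \<open>I \<in> A\<close>; by separability and the strong continuity of \<open>I \<mapsto> P I\<close> this makes
  \<open>A\<close> analytic. A category argument now gives some \<open>I\<close> such that \<open>I\<close> and its complement both lie in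
  \<open>A\<close>, that is, \<open>X \<simeq> X \<times> X\<close>. If \<open>X \<simeq> Y \<times> Z\<close> with \<open>Z \<simeq> X\<close> and \<open>Y \<simeq> X \<times> U\<close>, then
  \<open>Y \<simeq> X \<times> X \<times> U \<simeq> X \<times> Y \<simeq> X\<close>.
\<close>

section \<open>Category in the Cantor space\<close>

text \<open>Sets of naturals are the points of the Cantor space, and these are its basic clopen
  neighbourhoods.\<close>

definition cyl :: "nat set \<Rightarrow> nat \<Rightarrow> nat set set" where
  "cyl I k = {J. J \<inter> {..<k} = I \<inter> {..<k}}"

lemma cyl_self [simp]: "I \<in> cyl I k"
  by (simp add: cyl_def)

lemma mem_cyl_iff: "J \<in> cyl I k \<longleftrightarrow> (\<forall>i<k. i \<in> J \<longleftrightarrow> i \<in> I)"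
  by (auto simp: cyl_def)

lemma cyl_mono: "J \<in> cyl I k \<Longrightarrow> k \<le> m \<Longrightarrow> cyl J m \<subseteq> cyl I k"
  by (auto simp: mem_cyl_iff)

lemma cyl_fusion:
  assumes "\<And>k. I (Suc k) \<in> cyl (I k) (m k)" and "\<And>k. m k < m (Suc k)"
  obtains L where "\<And>k. L \<in> cyl (I k) (m k)"
proof
  have mono: "cyl (I j) (m j) \<subseteq> cyl (I k) (m k)" if "k \<le> j" for k j
    using that
  proof (induction rule: dec_induct)
    case (step j)
    then show ?case
      using cyl_mono[OF assms(1) less_imp_le[OF assms(2)]] by blast
  qed simp
  have large: "k \<le> m k" for k
    by (induction k) (use assms(2) Suc_leI le_less_trans in \<open>blast+\<close>)
  \<comment> \<open>Digit \<open>i\<close> is read off at stage \<open>Suc i\<close>, where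
    \<open>i < m (Suc i)\<close> ensures that it is already frozen.\<close>
  show "{i. i \<in> I (Suc i)} \<in> cyl (I k) (m k)" for k
    unfolding mem_cyl_iff
  proof (intro allI impI)
    fix i assume i: "i < m k"
    have "i < m (Suc i)"
      using large[of "Suc i"] by simp
    show "i \<in> {i. i \<in> I (Suc i)} \<longleftrightarrow> i \<in> I k"
    proof (cases "k \<le> Suc i")
      case True
      then show ?thesis
        using mono[OF True] cyl_self i by (metis mem_Collect_eq mem_cyl_iff subsetD)
    next
      case False
      then show ?thesis
        using mono[of "Suc i" k] cyl_self \<open>i < m (Suc i)\<close>
        by (metis mem_Collect_eq mem_cyl_iff subsetD nat_le_linear)
    qed
  qed
qed

text \<open>The conditions on \<open>J\<close> and \<open>m\<close> make \<open>cyl J m\<close> a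
  subcylinder of \<open>cyl I k\<close>; cylinders form a base, so testing on them is
  enough.\<close>

definition nowhere_dense :: "nat set set \<Rightarrow> bool" where
  "nowhere_dense M \<longleftrightarrow> (\<forall>I k. \<exists>J m. J \<in> cyl I k \<and> k \<le> m \<and> cyl J m \<inter> M = {})"

definition meager :: "nat set set \<Rightarrow> bool" where
  "meager M \<longleftrightarrow> (\<exists>F :: nat \<Rightarrow> nat set set. (\<forall>n. nowhere_dense (F n)) \<and> M \<subseteq> (\<Union>n. F n))"

lemma meagerI: "(\<And>n::nat. nowhere_dense (F n)) \<Longrightarrow> M \<subseteq> (\<Union>n. F n) \<Longrightarrow> meager M"
  unfolding meager_def by (intro exI[of _ F]) simp

lemma meager_subset: "meager N \<Longrightarrow> M \<subseteq> N \<Longrightarrow> meager M"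
  unfolding meager_def by blast

lemma nowhere_dense_imp_meager: "nowhere_dense M \<Longrightarrow> meager M"
  by (rule meagerI[of "\<lambda>_. M"]) auto

lemma meager_UN:
  assumes "\<And>n::nat. meager (M n)"
  shows "meager (\<Union>n. M n)"
proof -
  obtain F :: "nat \<Rightarrow> nat \<Rightarrow> nat set set"
    where "\<And>n l. nowhere_dense (F n l)" and "\<And>n. M n \<subseteq> (\<Union>l. F n l)"
    using assms unfolding meager_def by metis
  then have "(\<Union>n. M n) \<subseteq> (\<Union>i. case_prod F (prod_decode i))"
    by (auto simp: subset_iff) (metis case_prod_conv prod_encode_inverse)
  moreover have "nowhere_dense (case_prod F (prod_decode i))" for i
    using \<open>\<And>n l. nowhere_dense (F n l)\<close> by (simp add: split_beta)
  ultimately show ?thesis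
    by (intro meagerI)
qed

lemma meager_countable_Union:
  assumes "countable \<M>" and "\<And>M. M \<in> \<M> \<Longrightarrow> meager M"
  shows "meager (\<Union>\<M>)"
proof (cases "\<M> = {}")
  case True
  then show ?thesis
    by (intro nowhere_dense_imp_meager) (auto simp: nowhere_dense_def intro: cyl_self)
next
  case False
  then have "meager (\<Union>n. from_nat_into \<M> n)"
    by (intro meager_UN assms(2) from_nat_into)
  then show ?thesis
    by (simp only: range_from_nat_into[OF False assms(1)])
qed

lemma meager_Un: "meager M \<Longrightarrow> meager N \<Longrightarrow> meager (M \<union> N)"
  using meager_countable_Union[of "{M, N}"] by auto

text \<open>Baire's theorem: shrinking cylinders, each chosen to avoid the next \<open>F n\<close>,
  have a common point by fusion.\<close>

lemma not_meager_UNIV: "\<not> meager UNIV"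
proof
  assume "meager UNIV"
  then obtain F :: "nat \<Rightarrow> nat set set" where F: "\<And>n. nowhere_dense (F n)" "(\<Union>n. F n) = UNIV"
    unfolding meager_def by blast
  define R where "R n p q \<longleftrightarrow> fst q \<in> cyl (fst p) (snd p) \<and> snd p < snd q \<and>
      cyl (fst q) (snd q) \<inter> F n = {}" for n and p q :: "nat set \<times> nat"
  have "\<exists>q. R n p q" for n p
  proof -
    \<comment> \<open>Starting from \<open>Suc (snd p)\<close> makes the lengths strictly
      increasing, as the fusion demands.\<close>
    obtain J m where "J \<in> cyl (fst p) (Suc (snd p))" "Suc (snd p) \<le> m" "cyl J m \<inter> F n = {}"
      using F(1)[of n] unfolding nowhere_dense_def by blast
    then have "R n p (J, m)"
      by (auto simp: R_def mem_cyl_iff)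
    then show ?thesis ..
  qed
  then obtain s where s: "\<And>n. R n (s n) (s (Suc n))"
    using dependent_nat_choice[of "\<lambda>_ _. True" R] by auto
  obtain L where L: "\<And>k. L \<in> cyl (fst (s k)) (snd (s k))"
    using cyl_fusion[of "fst \<circ> s" "snd \<circ> s"] s unfolding R_def by auto
  have "L \<notin> F n" for n
    using L[of "Suc n"] s[of n] unfolding R_def by blast
  with F(2) show False
    by blast
qed

section \<open>Translations, local second category and analytic sets\<close>

text \<open>Translation by \<open>K\<close> in the group of sets under symmetric difference: an
  involution permuting the cylinders of each length. Complementation is the case
  \<open>K = UNIV\<close>.\<close>

definition flip :: "nat set \<Rightarrow> nat set \<Rightarrow> nat set" where
  "flip K I = sym_diff K I"

lemma mem_flip_iff: "i \<in> flip K I \<longleftrightarrow> (i \<in> K) \<noteq> (i \<in> I)"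
  by (auto simp: flip_def)

lemma flip_cyl: "flip K J \<in> cyl (flip K I) k \<longleftrightarrow> J \<in> cyl I k"
  by (auto simp: mem_cyl_iff mem_flip_iff)

lemma flip_flip: "flip K (flip K J) = J"
  by (auto simp: mem_flip_iff)

lemma mem_cyl_flip_iff: "J \<in> cyl (flip K I) k \<longleftrightarrow> flip K J \<in> cyl I k"
  by (auto simp: mem_cyl_iff mem_flip_iff)

lemma meager_flip:
  assumes "meager M"
  shows "meager (flip K -` M)"
proof -
  have nd: "nowhere_dense (flip K -` N)" if "nowhere_dense N" for N
    unfolding nowhere_dense_def
  proof (intro allI)
    fix I k
    obtain J m where J: "J \<in> cyl (flip K I) k" "k \<le> m" "cyl J m \<inter> N = {}"
      using \<open>nowhere_dense N\<close> unfolding nowhere_dense_def by blast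
    have "flip K J \<in> cyl I k"
      using J(1) by (simp add: mem_cyl_flip_iff)
    moreover have "cyl (flip K J) m \<inter> flip K -` N = {}"
      using J(3) by (auto simp: mem_cyl_flip_iff)
    ultimately show "\<exists>J m. J \<in> cyl I k \<and> k \<le> m \<and> cyl J m \<inter> flip K -` N = {}"
      using J(2) by blast
  qed
  obtain F :: "nat \<Rightarrow> nat set set" where F: "\<And>n. nowhere_dense (F n)" "M \<subseteq> (\<Union>n. F n)"
    using assms unfolding meager_def by blast
  then have "flip K -` M \<subseteq> (\<Union>n. flip K -` F n)"
    using vimage_mono[OF F(2)] by (simp add: vimage_UN)
  with nd[OF F(1)] show ?thesis
    by (intro meagerI)
qed

text \<open>Unlike being nonmeager in a single cylinder, this passes to subcylinders, which an
  iterated construction needs.\<close>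

definition thick :: "nat set set \<Rightarrow> nat set \<Rightarrow> nat \<Rightarrow> bool" where
  "thick M I k \<longleftrightarrow> (\<forall>J m. J \<in> cyl I k \<longrightarrow> k \<le> m \<longrightarrow> \<not> meager (M \<inter> cyl J m))"

lemma thickD: "thick M I k \<Longrightarrow> J \<in> cyl I k \<Longrightarrow> k \<le> m \<Longrightarrow> thick M J m"
  unfolding thick_def by (meson cyl_mono le_trans subsetD)

lemma thick_subset: "thick M I k \<Longrightarrow> M \<subseteq> N \<Longrightarrow> thick N I k"
  unfolding thick_def using meager_subset[OF _ Int_mono[OF _ order_refl]] by blast

text \<open>Otherwise every subcylinder of \<open>cyl I k\<close> contains a cylinder on which
  \<open>M\<close> is meager. There are only countably many cylinders, so \<open>M\<close> is meager
  on the union of these, and what they leave of \<open>cyl I k\<close> is nowhere dense.\<close>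

lemma not_meager_imp_thick:
  assumes "\<not> meager (M \<inter> cyl I k)"
  obtains J m where "J \<in> cyl I k" "k \<le> m" "thick M J m"
proof (rule ccontr)
  assume "\<not> thesis"
  with that have not_thick: "\<not> thick M J m" if "J \<in> cyl I k" "k \<le> m" for J m
    using that by blast
  \<comment> \<open>A cylinder depends only on its length and a finite trace, so finite sets as
    centres give all of them, and countably many.\<close>
  define \<N> where "\<N> = {N \<in> case_prod cyl ` (Collect finite \<times> UNIV). meager (M \<inter> N)}"
  have "countable \<N>"
    unfolding \<N>_def by (intro countable_Collect countable_image countable_SIGMA countable_Collect_finite) auto
  then have "meager (\<Union>N\<in>\<N>. M \<inter> N)"
    by (intro meager_countable_Union) (auto simp: \<N>_def)
  moreover have "nowhere_dense (cyl I k - \<Union>\<N>)"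
    unfolding nowhere_dense_def
  proof (intro allI)
    fix J m
    show "\<exists>J' m'. J' \<in> cyl J m \<and> m \<le> m' \<and> cyl J' m' \<inter> (cyl I k - \<Union>\<N>) = {}"
    \<comment> \<open>At length \<open>max m k\<close> a cylinder is either disjoint from
      \<open>cyl I k\<close> or contained in it.\<close>
    proof (cases "cyl J (max m k) \<inter> cyl I k = {}")
      case True
      then show ?thesis
        by (intro exI[of _ J] exI[of _ "max m k"]) auto
    next
      case False
      then have "J \<in> cyl I k"
        by (auto simp: mem_cyl_iff)
      then obtain J' m' where J': "J' \<in> cyl J (max m k)" "max m k \<le> m'" "meager (M \<inter> cyl J' m')"
        using not_thick[of J "max m k"] unfolding thick_def by auto
      have "cyl J' m' = case_prod cyl (J' \<inter> {..<m'}, m')"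
        by (auto simp: mem_cyl_iff)
      then have "cyl J' m' \<in> \<N>"
        unfolding \<N>_def using J'(3) by blast
      moreover have "J' \<in> cyl J m"
        using J'(1) by (simp add: mem_cyl_iff)
      ultimately show ?thesis
        using J'(2) by (intro exI[of _ J'] exI[of _ m']) auto
    qed
  qed
  ultimately have "meager ((\<Union>N\<in>\<N>. M \<inter> N) \<union> (cyl I k - \<Union>\<N>))"
    by (intro meager_Un[OF _ nowhere_dense_imp_meager])
  then have "meager (M \<inter> cyl I k)"
    by (rule meager_subset) blast
  with assms show False ..
qed

text \<open>This selects the next digit of a witness: one of countably many pieces is nonmeager,
  hence thick after shrinking.\<close>

lemma thick_UN:
  assumes "thick M I k" and "M \<subseteq> (\<Union>l::nat. N l)"
  obtains l J m where "J \<in> cyl I k" "k \<le> m" "thick (N l) J m"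
proof -
  have "\<exists>l. \<not> meager (N l \<inter> cyl I k)"
  proof (rule ccontr)
    assume "\<nexists>l. \<not> meager (N l \<inter> cyl I k)"
    then have "meager (\<Union>l. N l \<inter> cyl I k)"
      by (intro meager_UN) blast
    then have "meager (M \<inter> cyl I k)"
      by (rule meager_subset) (use assms(2) in blast)
    then show False
      using assms(1) cyl_self unfolding thick_def by blast
  qed
  then show ?thesis
    using not_meager_imp_thick that by metis
qed

text \<open>Analytic sets: \<open>S v\<close> stands for the set of those \<open>I\<close> that have a witness whose first digits are \<open>v\<close>,
  and the last clause says that the relation between \<open>I\<close> and its witnesses is closed.\<close>

definition souslin :: "nat set set \<Rightarrow> bool" where
  "souslin A \<longleftrightarrow> (\<exists>S :: nat list \<Rightarrow> nat set set.
     A \<subseteq> S [] \<and> (\<forall>v. S v \<subseteq> (\<Union>l. S (v @ [l]))) \<and>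
     (\<forall>I b. (\<forall>k. S (map b [0..<k]) \<inter> cyl I k \<noteq> {}) \<longrightarrow> I \<in> A))"

text \<open>Cylinders go to cylinders of the same length, so the preimages of a scheme for
  \<open>A\<close> are again a scheme.\<close>

lemma souslin_flip:
  assumes "souslin A"
  shows "souslin (flip K -` A)"
proof -
  obtain S :: "nat list \<Rightarrow> nat set set" where S: "A \<subseteq> S []" "\<And>v. S v \<subseteq> (\<Union>l. S (v @ [l]))"
    "\<And>I b. (\<forall>k. S (map b [0..<k]) \<inter> cyl I k \<noteq> {}) \<Longrightarrow> I \<in> A"
    using assms unfolding souslin_def by blast
  have "flip K I \<in> A" if *: "\<forall>k. flip K -` S (map b [0..<k]) \<inter> cyl I k \<noteq> {}" for I b
  proof (rule S(3)[of b], rule allI)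
    fix k
    obtain J where "flip K J \<in> S (map b [0..<k])" "J \<in> cyl I k"
      using * by blast
    then show "S (map b [0..<k]) \<inter> cyl (flip K I) k \<noteq> {}"
      using flip_cyl[of K J I k] by blast
  qed
  moreover have "flip K -` A \<subseteq> flip K -` S []"
    using S(1) by blast
  moreover have "flip K -` S v \<subseteq> (\<Union>l. flip K -` S (v @ [l]))" for v
    using S(2)[of v] by blast
  ultimately show ?thesis
    unfolding souslin_def by (intro exI[of _ "\<lambda>v. flip K -` S v"]) auto
qed

text \<open>Fusion: the two sets are refined alternately inside a shrinking cylinder, each time fixing one
  more digit of a witness for either of them.\<close>

lemma thick_souslin_Int:
  assumes "souslin A" "souslin B" and "thick A I k" "thick B I k"
  shows "A \<inter> B \<noteq> {}"
proof -
  obtain S :: "nat list \<Rightarrow> nat set set" where S: "A \<subseteq> S []" "\<And>v. S v \<subseteq> (\<Union>l. S (v @ [l]))"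
    "\<And>I b. (\<forall>k. S (map b [0..<k]) \<inter> cyl I k \<noteq> {}) \<Longrightarrow> I \<in> A"
    using assms(1) unfolding souslin_def by blast
  obtain T :: "nat list \<Rightarrow> nat set set" where T: "B \<subseteq> T []" "\<And>v. T v \<subseteq> (\<Union>l. T (v @ [l]))"
    "\<And>I b. (\<forall>k. T (map b [0..<k]) \<inter> cyl I k \<noteq> {}) \<Longrightarrow> I \<in> B"
    using assms(2) unfolding souslin_def by blast
  \<comment> \<open>State of the fusion at stage \<open>n\<close>: \<open>n\<close> digits for each
    of the two witnesses, and a cylinder in which both corresponding sets are still thick.\<close>
  define Q where "Q n = (\<lambda>(v, w, J, m). length v = n \<and> length w = n \<and> n \<le> m \<and>
     thick (S v) J m \<and> thick (T w) J m)" for n :: nat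
  define R where "R = (\<lambda>(v, w, J, m) (v', w', J', m').
     (\<exists>a::nat. v' = v @ [a]) \<and> (\<exists>a::nat. w' = w @ [a]) \<and> J' \<in> cyl J m \<and> m < (m'::nat))"
  have "\<exists>s. Q 0 s"
    using thick_subset[OF assms(3) S(1)] thick_subset[OF assms(4) T(1)]
    by (intro exI[of _ "([], [], I, k)"]) (simp add: Q_def)
  moreover have "\<exists>s'. Q (Suc n) s' \<and> R s s'" if "Q n s" for n s
  proof -
    obtain v w J m where s: "s = (v, w, J, m)"
      by (cases s) auto
    have Q: "length v = n" "length w = n" "n \<le> m" "thick (S v) J m" "thick (T w) J m"
      using that by (auto simp: Q_def s)
    obtain a J1 m1 where 1: "J1 \<in> cyl J m" "m \<le> m1" "thick (S (v @ [a])) J1 m1"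
      using thick_UN[OF Q(4) S(2)] by metis
    \<comment> \<open>\<open>T w\<close> is still thick in the cylinder just chosen for
      \<open>S\<close>, so the second refinement can be made inside it.\<close>
    obtain c J2 m2 where 2: "J2 \<in> cyl J1 m1" "m1 \<le> m2" "thick (T (w @ [c])) J2 m2"
      using thick_UN[OF thickD[OF Q(5) 1(1,2)] T(2)] by metis
    have "J2 \<in> cyl J m"
      using cyl_mono[OF 1(1,2)] 2(1) by blast
    moreover have "thick (S (v @ [a])) J2 (Suc m2)"
      using thickD[OF 1(3) 2(1)] 2(2) by simp
    moreover have "thick (T (w @ [c])) J2 (Suc m2)"
      using thickD[OF 2(3) cyl_self] by simp
    ultimately show ?thesis
      using Q 1(2) 2(2)
      by (intro exI[of _ "(v @ [a], w @ [c], J2, Suc m2)"]) (auto simp: Q_def R_def s)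
  qed
  ultimately obtain s where s: "\<And>n. Q n (s n)" "\<And>n. R (s n) (s (Suc n))"
    using dependent_nat_choice[of Q "\<lambda>_. R"] by metis
  define v w J m where "v = fst \<circ> s" and "w = fst \<circ> snd \<circ> s"
    and "J = fst \<circ> snd \<circ> snd \<circ> s" and "m = snd \<circ> snd \<circ> snd \<circ> s"
  have Q: "length (v n) = n" "length (w n) = n" "n \<le> m n"
      "thick (S (v n)) (J n) (m n)" "thick (T (w n)) (J n) (m n)"
    and R: "\<exists>a. v (Suc n) = v n @ [a]" "\<exists>a. w (Suc n) = w n @ [a]"
      "J (Suc n) \<in> cyl (J n) (m n)" "m n < m (Suc n)" for n
    using s(1)[of n] s(2)[of n]
    by (simp_all add: Q_def R_def v_def w_def J_def m_def split_beta)
  \<comment> \<open>The growing lists are the initial segments of one infinite sequence, whose digit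
    \<open>i\<close> is available from stage \<open>Suc i\<close> on.\<close>
  have prefix: "u n = map (\<lambda>i. u (Suc i) ! i) [0..<n]"
    if len: "\<And>n. length (u n) = n" and app: "\<And>n. \<exists>a. u (Suc n) = u n @ [a]" for u :: "nat \<Rightarrow> nat list" and n
  proof (induction n)
    case (Suc n)
    obtain a where "u (Suc n) = u n @ [a]"
      using app by blast
    with Suc show ?case
      using len[of n] by (simp add: nth_append)
  qed (use len[of 0] in simp)
  obtain L where L: "\<And>n. L \<in> cyl (J n) (m n)"
    using cyl_fusion[of J m, OF R(3,4)] by blast
  \<comment> \<open>Thickness makes \<open>N\<close> nonmeager, hence nonempty, near
    \<open>L\<close>; since \<open>n \<le> m n\<close>, the coarser cylinder of length
    \<open>n\<close> is met too, as the closedness clause requires.\<close>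
  have meets: "N \<inter> cyl L n \<noteq> {}" if "thick N (J n) (m n)" for N n
  proof -
    have "\<not> meager (N \<inter> cyl L (m n))"
      using that L unfolding thick_def by blast
    moreover have "meager {}"
      using meager_countable_Union[of "{}"] by simp
    ultimately have "N \<inter> cyl L (m n) \<noteq> {}"
      by metis
    then show ?thesis
      using cyl_mono[OF cyl_self Q(3)] by blast
  qed
  have "L \<in> A"
    using S(3)[of "\<lambda>i. v (Suc i) ! i" L] meets[OF Q(4)] prefix[of v, OF Q(1) R(1)] by metis
  moreover have "L \<in> B"
    using T(3)[of "\<lambda>i. w (Suc i) ! i" L] meets[OF Q(5)] prefix[of w, OF Q(2) R(2)] by metis
  ultimately show ?thesis
    by blast
qed

text \<open>In other words, no nonprincipal ultrafilter on the natural numbers is analytic.\<close>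

lemma souslin_contains_complementary_pair:
  assumes "souslin A"
    and "\<And>i I. i \<notin> I \<Longrightarrow> insert i I \<in> A \<longleftrightarrow> I \<in> A"
    and "\<And>I. I \<in> A \<or> - I \<in> A"
  obtains I where "I \<in> A" "- I \<in> A"
proof -
  \<comment> \<open>One element is changed at a time; a removal is an insertion read
    backwards.\<close>
  have tail: "flip F I \<in> A \<longleftrightarrow> I \<in> A" if "finite F" for F I
    using that
  proof (induction F)
    case (insert i F)
    have "flip (insert i F) I \<in> A \<longleftrightarrow> flip F I \<in> A"
    proof (cases "i \<in> I")
      case True
      then have "flip F I = insert i (flip (insert i F) I)"
        using insert.hyps by (auto simp: mem_flip_iff)
      then show ?thesis
        using assms(2)[of i "flip (insert i F) I"] True by (auto simp: mem_flip_iff)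
    next
      case False
      then have "flip (insert i F) I = insert i (flip F I)"
        using insert.hyps by (auto simp: mem_flip_iff)
      then show ?thesis
        using assms(2)[of i "flip F I"] insert.hyps False by (auto simp: mem_flip_iff)
    qed
    with insert.IH show ?case
      by blast
  qed (simp add: flip_def)
  have compl: "uminus -` A = flip UNIV -` A"
    by (auto simp: flip_def Compl_eq_Diff_UNIV)
  \<comment> \<open>By the dichotomy \<open>A\<close> and its translate by \<open>UNIV\<close> cover
    the space, and translation preserves meagerness.\<close>
  have "\<not> meager A"
  proof
    assume "meager A"
    then have "meager (A \<union> uminus -` A)"
      unfolding compl by (intro meager_Un meager_flip)
    moreover have "A \<union> uminus -` A = UNIV"
      using assms(3) by auto
    ultimately show False
      using not_meager_UNIV by simp
  qed
  then have "\<not> meager (A \<inter> cyl {} 0)"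
    by (simp add: cyl_def)
  then obtain J m where A: "thick A J m"
    using not_meager_imp_thick by metis
  \<comment> \<open>Complementing and flipping the digits from \<open>m\<close> on differ only in
    the first \<open>m\<close> digits, a finite change that \<open>A\<close> does not see.\<close>
  have compl_tail: "- I \<in> A \<longleftrightarrow> flip {m..} I \<in> A" for I
  proof -
    have "flip {..<m} (- I) = flip {m..} I"
      by (auto simp: mem_flip_iff)
    then show ?thesis
      using tail[of "{..<m}" "- I"] by (simp del: Compl_iff)
  qed
  \<comment> \<open>\<open>flip {m..}\<close> keeps the first \<open>m\<close> digits and so
    preserves \<open>cyl J m\<close>. It therefore carries the thickness of \<open>A\<close> in this
    very cylinder over to the set of complements, and the two analytic sets must meet.\<close>
  have "thick (uminus -` A) J m"
    unfolding thick_def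
  proof (intro allI impI)
    fix K n assume K: "K \<in> cyl J m" "m \<le> n"
    show "\<not> meager (uminus -` A \<inter> cyl K n)"
    proof
      assume "meager (uminus -` A \<inter> cyl K n)"
      then have "meager (flip {m..} -` (uminus -` A \<inter> cyl K n))"
        by (rule meager_flip)
      moreover have "A \<inter> cyl (flip {m..} K) n \<subseteq> flip {m..} -` (uminus -` A \<inter> cyl K n)"
      proof
        fix L assume "L \<in> A \<inter> cyl (flip {m..} K) n"
        then show "L \<in> flip {m..} -` (uminus -` A \<inter> cyl K n)"
          using compl_tail[of "flip {m..} L"] by (simp add: mem_cyl_flip_iff flip_flip)
      qed
      ultimately have "meager (A \<inter> cyl (flip {m..} K) n)"
        by (rule meager_subset)
      moreover have "flip {m..} K \<in> cyl J m"
        using K(1) by (auto simp: mem_cyl_iff mem_flip_iff)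
      ultimately show False
        using A K(2) unfolding thick_def by blast
    qed
  qed
  moreover have "souslin (uminus -` A)"
    unfolding compl by (rule souslin_flip[OF assms(1)])
  ultimately show ?thesis
    using thick_souslin_Int[OF assms(1) _ A] that by blast
qed

section \<open>Isomorphisms and direct sums\<close>

lemma isomorphic_spacesI:
  assumes "homeomorphism S T f g"
    and "\<And>x y. x \<in> S \<Longrightarrow> y \<in> S \<Longrightarrow> f (x + y) = f x + f y"
    and "\<And>c x. x \<in> S \<Longrightarrow> f (c *\<^sub>R x) = c *\<^sub>R f x"
  shows "S \<simeq> T"
  unfolding isomorphic_spaces_def using assms by blast

lemma isomorphic_spacesE:
  assumes "S \<simeq> T"
  obtains f g where "homeomorphism S T f g"
    and "\<And>x y. x \<in> S \<Longrightarrow> y \<in> S \<Longrightarrow> f (x + y) = f x + f y"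
    and "\<And>c x. x \<in> S \<Longrightarrow> f (c *\<^sub>R x) = c *\<^sub>R f x"
  using assms unfolding isomorphic_spaces_def by blast

lemma isomorphic_spacesI_bounded_linear:
  assumes "bounded_linear f" "bounded_linear g" "f ` S \<subseteq> T" "g ` T \<subseteq> S"
    and "\<And>x. x \<in> S \<Longrightarrow> g (f x) = x" "\<And>y. y \<in> T \<Longrightarrow> f (g y) = y"
  shows "S \<simeq> T"
proof (rule isomorphic_spacesI)
  show "homeomorphism S T f g"
    by (intro homeomorphismI linear_continuous_on assms)
qed (use assms(1) bounded_linear.linear linear_add linear_cmul in blast)+

lemma isomorphic_spaces_refl: "S \<simeq> S"
  by (rule isomorphic_spacesI[OF homeomorphism_ident]) auto

lemma isomorphic_spaces_trans:
  assumes "S \<simeq> T" "T \<simeq> R"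
  shows "S \<simeq> R"
proof -
  obtain f g where f: "homeomorphism S T f g"
    "\<And>x y. x \<in> S \<Longrightarrow> y \<in> S \<Longrightarrow> f (x + y) = f x + f y"
    "\<And>c x. x \<in> S \<Longrightarrow> f (c *\<^sub>R x) = c *\<^sub>R f x"
    using isomorphic_spacesE[OF assms(1)] by metis
  obtain h k where h: "homeomorphism T R h k"
    "\<And>x y. x \<in> T \<Longrightarrow> y \<in> T \<Longrightarrow> h (x + y) = h x + h y"
    "\<And>c x. x \<in> T \<Longrightarrow> h (c *\<^sub>R x) = c *\<^sub>R h x"
    using isomorphic_spacesE[OF assms(2)] by metis
  have "f x \<in> T" if "x \<in> S" for x
    using homeomorphism_image1[OF f(1)] that by blast
  then show ?thesis
    by (intro isomorphic_spacesI[OF homeomorphism_compose[OF f(1) h(1)]]) (simp_all add: f h)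
qed

text \<open>Linearity of the inverse comes from applying \<open>g\<close> to
  \<open>f (g u + g v)\<close>; that \<open>S\<close> is a subspace keeps the argument in the domain
  of \<open>f\<close>.\<close>

lemma isomorphic_spaces_sym:
  assumes "S \<simeq> T" "subspace S"
  shows "T \<simeq> S"
proof -
  obtain f g where f: "homeomorphism S T f g"
    "\<And>x y. x \<in> S \<Longrightarrow> y \<in> S \<Longrightarrow> f (x + y) = f x + f y"
    "\<And>c x. x \<in> S \<Longrightarrow> f (c *\<^sub>R x) = c *\<^sub>R f x"
    using isomorphic_spacesE[OF assms(1)] by metis
  have g: "g u \<in> S" "f (g u) = u" if "u \<in> T" for u
    using f(1) that by (auto simp: homeomorphism_def)
  have gf: "g (f x) = x" if "x \<in> S" for x
    using homeomorphism_apply1[OF f(1) that] .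
  show ?thesis
  proof (rule isomorphic_spacesI[OF homeomorphism_symD[OF f(1)]])
    fix u v assume "u \<in> T" "v \<in> T"
    then show "g (u + v) = g u + g v"
      using gf[of "g u + g v"] g f(2)[of "g u" "g v"] subspace_add[OF assms(2)] by metis
  next
    fix c u assume "u \<in> T"
    then show "g (c *\<^sub>R u) = c *\<^sub>R g u"
      using gf[of "c *\<^sub>R g u"] g f(3)[of "g u" c] subspace_scale[OF assms(2)] by metis
  qed
qed

lemma isomorphic_spaces_Times:
  assumes "S \<simeq> S'" "T \<simeq> T'"
  shows "S \<times> T \<simeq> S' \<times> T'"
proof -
  obtain f f' where f: "homeomorphism S S' f f'"
    "\<And>x y. x \<in> S \<Longrightarrow> y \<in> S \<Longrightarrow> f (x + y) = f x + f y"
    "\<And>c x. x \<in> S \<Longrightarrow> f (c *\<^sub>R x) = c *\<^sub>R f x"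
    using isomorphic_spacesE[OF assms(1)] by metis
  obtain h h' where h: "homeomorphism T T' h h'"
    "\<And>x y. x \<in> T \<Longrightarrow> y \<in> T \<Longrightarrow> h (x + y) = h x + h y"
    "\<And>c x. x \<in> T \<Longrightarrow> h (c *\<^sub>R x) = c *\<^sub>R h x"
    using isomorphic_spacesE[OF assms(2)] by metis
  have cont: "continuous_on (A \<times> B) (map_prod p q)"
    if "continuous_on A p" "continuous_on B q"
    for p :: "'e::topological_space \<Rightarrow> 'f::topological_space"
      and q :: "'g::topological_space \<Rightarrow> 'h::topological_space" and A B
    unfolding map_prod_def split_beta
    by (intro continuous_on_Pair continuous_on_compose2[OF that(1)] continuous_on_compose2[OF that(2)]
        continuous_intros) auto
  show ?thesis
  proof (rule isomorphic_spacesI)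
    show "homeomorphism (S \<times> T) (S' \<times> T') (map_prod f h) (map_prod f' h')"
      using f(1) h(1) by (intro homeomorphismI cont) (auto simp: homeomorphism_def)
  qed (auto simp: f h)
qed

lemma isomorphic_spaces_Times_commute: "S \<times> T \<simeq> T \<times> S"
  by (rule isomorphic_spacesI_bounded_linear[of "\<lambda>p. (snd p, fst p)" "\<lambda>p. (snd p, fst p)"])
    (auto intro: bounded_linear_Pair bounded_linear_fst bounded_linear_snd)

lemma isomorphic_spaces_Times_assoc: "(S \<times> T) \<times> R \<simeq> S \<times> T \<times> R"
proof (rule isomorphic_spacesI_bounded_linear)
  show "bounded_linear (\<lambda>p :: ('a \<times> 'b) \<times> 'c. (fst (fst p), snd (fst p), snd p))"
    by (intro bounded_linear_Pair bounded_linear_compose[OF bounded_linear_fst]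
        bounded_linear_compose[OF bounded_linear_snd] bounded_linear_fst bounded_linear_snd)
  show "bounded_linear (\<lambda>p :: 'a \<times> 'b \<times> 'c. ((fst p, fst (snd p)), snd (snd p)))"
    by (intro bounded_linear_Pair bounded_linear_compose[OF bounded_linear_fst]
        bounded_linear_compose[OF bounded_linear_snd] bounded_linear_fst bounded_linear_snd)
qed auto

text \<open>The open mapping theorem for the addition map from \<open>Y \<times> Z\<close>: by the Baire category theorem its image of
  a ball is dense in a ball, and successive approximation removes the closure.\<close>

lemma direct_sum_decomposition_bound:
  fixes Y Z :: "'a::banach set"
  assumes "direct_sum_decomposition Y Z"
  obtains K where "\<And>y z. y \<in> Y \<Longrightarrow> z \<in> Z \<Longrightarrow> norm y \<le> K * norm (y + z)"
proof -
  have Y: "subspace Y" "closed Y" and Z: "subspace Z" "closed Z"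
    and sum: "\<And>x. \<exists>y\<in>Y. \<exists>z\<in>Z. x = y + z" and Int: "Y \<inter> Z = {0}"
    using assms unfolding direct_sum_decomposition_def by blast+
  define B where "B n = {y + z | y z. y \<in> Y \<and> z \<in> Z \<and> norm y \<le> real n \<and> norm z \<le> real n}" for n
  have "\<exists>n. interior (closure (B n)) \<noteq> {}"
  proof (rule ccontr)
    assume "\<nexists>n. interior (closure (B n)) \<noteq> {}"
    then have empty: "interior (closure (B n)) = {}" for n
      by blast
    have "Met_TC.mtopology interior_of \<Union>(range (\<lambda>n. closure (B n))) = {}"
    proof (rule Met_TC.metric_Baire_category_alt)
      show "Met_TC.mcomplete TYPE('a)"
        by (simp add: complete_UNIV)
      fix T assume "T \<in> range (\<lambda>n. closure (B n))"
      then obtain n where "T = closure (B n)" ..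
      then show "closedin Met_TC.mtopology T \<and> Met_TC.mtopology interior_of T = {}"
        by (simp add: empty)
    qed auto
    then have "interior (\<Union>n. closure (B n)) = {}"
      by simp
    moreover have "x \<in> (\<Union>n. closure (B n))" for x
    proof -
      obtain y z where "y \<in> Y" "z \<in> Z" "x = y + z"
        using sum by blast
      moreover obtain n where "max (norm y) (norm z) \<le> real n"
        using real_arch_simple by blast
      ultimately have "x \<in> B n"
        by (auto simp: B_def)
      then show ?thesis
        using closure_subset by blast
    qed
    then have "(\<Union>n. closure (B n)) = UNIV"
      by blast
    ultimately show False
      by simp
  qed
  then obtain n x0 r where r: "0 < r" "ball x0 r \<subseteq> closure (B n)"
    by (metis all_not_in_conv mem_interior)
  \<comment> \<open>A nonzero \<open>v\<close> is scaled to length \<open>r / 2\<close> by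
    \<open>c = 2 * norm v / r\<close>. Differences of elements of \<open>B n\<close> have parts of
    norm at most \<open>2 * n\<close>, and \<open>c * 2 * n = K * norm v\<close>.\<close>
  define K where "K = 4 * real n / r"
  have approx: "\<exists>y\<in>Y. \<exists>z\<in>Z. norm y \<le> K * norm v \<and> norm z \<le> K * norm v \<and>
      norm (v - y - z) \<le> norm v / 2" for v
  proof (cases "v = 0")
    case True
    then show ?thesis
      using subspace_0[OF Y(1)] subspace_0[OF Z(1)] by force
  next
    case False
    define c where "c = 2 * norm v / r"
    have c: "c > 0" "c * (2 * real n) = K * norm v" "c * (r / 4) = norm v / 2"
      using False r(1) by (auto simp: c_def K_def field_simps)
    have "norm (v /\<^sub>R c) = r / 2"
      using False r(1) by (simp add: c_def)
    then have "x0 + v /\<^sub>R c \<in> closure (B n)" "x0 \<in> closure (B n)"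
      using r by (auto simp: subset_iff dist_norm)
    \<comment> \<open>The centre \<open>x0\<close> cancels in \<open>b - b'\<close>, which is thus
      within \<open>r / 4\<close> of the rescaled \<open>v\<close>; scaling back turns this error
      into \<open>norm v / 2\<close>.\<close>
    then obtain b b' where b: "b \<in> B n" "b' \<in> B n" "dist b (x0 + v /\<^sub>R c) < r / 8" "dist b' x0 < r / 8"
      using r(1) unfolding closure_approachable by (meson divide_pos_pos zero_less_numeral)
    obtain y z where y: "b = y + z" "y \<in> Y" "z \<in> Z" "norm y \<le> real n" "norm z \<le> real n"
      using b(1) unfolding B_def by blast
    obtain y' z' where y': "b' = y' + z'" "y' \<in> Y" "z' \<in> Z" "norm y' \<le> real n" "norm z' \<le> real n"
      using b(2) unfolding B_def by blast
    have norms: "norm (y - y') \<le> 2 * real n" "norm (z - z') \<le> 2 * real n"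
      using norm_triangle_ineq4[of y y'] norm_triangle_ineq4[of z z'] y y' by linarith+
    have "norm (v /\<^sub>R c - (y - y') - (z - z')) = norm ((b' - x0) - (b - (x0 + v /\<^sub>R c)))"
      by (simp add: y(1) y'(1) algebra_simps)
    also have "\<dots> \<le> r / 4"
      using norm_triangle_ineq4[of "b' - x0" "b - (x0 + v /\<^sub>R c)"] b(3,4)
      by (simp add: dist_norm)
    finally have close: "norm (v /\<^sub>R c - (y - y') - (z - z')) \<le> r / 4" .
    show ?thesis
    proof (intro bexI conjI)
      show "norm (c *\<^sub>R (y - y')) \<le> K * norm v" "norm (c *\<^sub>R (z - z')) \<le> K * norm v"
        using norms[THEN mult_left_mono, of c] c by auto
      have "v - c *\<^sub>R (y - y') - c *\<^sub>R (z - z') = c *\<^sub>R (v /\<^sub>R c - (y - y') - (z - z'))"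
        using c(1) by (simp add: algebra_simps)
      then have "norm (v - c *\<^sub>R (y - y') - c *\<^sub>R (z - z')) =
          c * norm (v /\<^sub>R c - (y - y') - (z - z'))"
        using c(1) by (simp only: norm_scaleR abs_of_pos)
      also have "\<dots> \<le> norm v / 2"
        using mult_left_mono[OF close, of c] c(1) by (simp only: c(3) less_imp_le)
      finally show "norm (v - c *\<^sub>R (y - y') - c *\<^sub>R (z - z')) \<le> norm v / 2" .
    qed (use y y' Y(1) Z(1) in \<open>auto intro: subspace_scale subspace_diff\<close>)
  qed
  then obtain p q where p: "\<And>v. p v \<in> Y" "\<And>v. norm (p v) \<le> K * norm v"
    and q: "\<And>v. q v \<in> Z" "\<And>v. norm (q v) \<le> K * norm v"
    and pq: "\<And>v. norm (v - p v - q v) \<le> norm v / 2"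
    by metis
  have "K \<ge> 0"
    using r(1) by (simp add: K_def)
  have bound: "norm y \<le> (2 * K) * norm (y + z)" if yz: "y \<in> Y" "z \<in> Z" for y z
  proof -
    \<comment> \<open>\<open>v k\<close> is what remains of \<open>y + z\<close> after
      \<open>k\<close> corrections. Its norm at least halves each time, so the corrections in
      \<open>Y\<close> and in \<open>Z\<close> form convergent series.\<close>
    define v where "v = rec_nat (y + z) (\<lambda>_ v. v - p v - q v)"
    have v: "v 0 = y + z" "v (Suc k) = v k - p (v k) - q (v k)" for k
      by (simp_all add: v_def)
    have v_le: "norm (v k) \<le> norm (y + z) * (1 / 2) ^ k" for k
    proof (induction k)
      case (Suc k)
      then show ?case
        using pq[of "v k"] by (simp add: v(2))
    qed (simp add: v)
    have summand: "norm (h (v k)) \<le> K * norm (y + z) * (1 / 2) ^ k"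
      if "\<And>u. norm (h u) \<le> K * norm u" for k and h :: "'a \<Rightarrow> 'a"
      using that[of "v k"] mult_left_mono[OF v_le \<open>K \<ge> 0\<close>, of k] by (simp add: mult.assoc)
    have geometric: "(\<lambda>k. K * norm (y + z) * (1 / 2) ^ k) sums (2 * K * norm (y + z))"
      using sums_mult[OF geometric_sums[of "1 / 2 :: real"], of "K * norm (y + z)"]
      by (simp add: mult_ac)
    have summable: "summable (\<lambda>k. h (v k))"
      if "\<And>u. norm (h u) \<le> K * norm u" for h :: "'a \<Rightarrow> 'a"
      by (rule summable_comparison_test'[OF sums_summable[OF geometric], of 0])
        (rule summand[of h, OF that])
    have in_closed: "(\<Sum>k. h (v k)) \<in> M"
      if "\<And>u. norm (h u) \<le> K * norm u" "\<And>u. h u \<in> M" "subspace M" "closed M"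
      for h :: "'a \<Rightarrow> 'a" and M
    proof (rule closed_sequentially[OF \<open>closed M\<close>])
      show "(\<lambda>n. \<Sum>k<n. h (v k)) \<longlonglongrightarrow> (\<Sum>k. h (v k))"
        using summable_sums[OF summable[of h, OF that(1)]] by (simp add: sums_def)
    qed (use that in \<open>auto intro: subspace_sum\<close>)
    have "(\<Sum>k<n. p (v k) + q (v k)) = y + z - v n" for n
      by (induction n) (simp_all add: v algebra_simps)
    moreover have "v \<longlonglongrightarrow> 0"
    proof (rule Lim_null_comparison)
      show "(\<lambda>k. norm (y + z) * (1 / 2) ^ k) \<longlonglongrightarrow> 0"
        by (intro tendsto_mult_right_zero LIMSEQ_realpow_zero) auto
    qed (use v_le in auto)
    ultimately have "(\<lambda>k. p (v k) + q (v k)) sums (y + z)"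
      unfolding sums_def using tendsto_diff[OF tendsto_const, of v 0 sequentially "y + z"] by simp
    then have "y + z = (\<Sum>k. p (v k)) + (\<Sum>k. q (v k))"
      using sums_add[OF summable_sums[OF summable] summable_sums[OF summable], of p q] p q
      by (metis sums_unique2)
    \<comment> \<open>One side lies in \<open>Y\<close> and the other in \<open>Z\<close>, so both
      vanish: \<open>y\<close> is the sum of the corrections in \<open>Y\<close>, and their
      geometric bound sums to \<open>2 * K * norm (y + z)\<close>.\<close>
    then have "y - (\<Sum>k. p (v k)) = (\<Sum>k. q (v k)) - z"
      by (simp add: algebra_simps)
    moreover have "y - (\<Sum>k. p (v k)) \<in> Y"
      by (intro subspace_diff Y yz in_closed p)
    moreover have "(\<Sum>k. q (v k)) - z \<in> Z"
      by (intro subspace_diff Z yz in_closed q)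
    ultimately have "y - (\<Sum>k. p (v k)) \<in> Y \<inter> Z"
      by simp
    then have "y = (\<Sum>k. p (v k))"
      by (simp add: Int)
    also have "norm \<dots> \<le> (\<Sum>k. K * norm (y + z) * (1 / 2) ^ k)"
      by (intro norm_suminf_le summand p sums_summable[OF geometric])
    finally show ?thesis
      using geometric by (simp add: sums_iff)
  qed
  then show ?thesis
    by (rule that)
qed

text \<open>The map sends \<open>x\<close> to \<open>(p x, x - p x)\<close>. Uniqueness of the parts
  makes \<open>p\<close> linear, and the preceding bound makes it continuous.\<close>

lemma direct_sum_decomposition_isomorphic:
  fixes Y Z :: "'a::banach set"
  assumes "direct_sum_decomposition Y Z"
  shows "(UNIV :: 'a set) \<simeq> Y \<times> Z"
proof -
  have Y: "subspace Y" and Z: "subspace Z"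
    and sum: "\<And>x. \<exists>y\<in>Y. \<exists>z\<in>Z. x = y + z" and Int: "Y \<inter> Z = {0}"
    using assms unfolding direct_sum_decomposition_def by blast+
  obtain K where K: "\<And>y z. y \<in> Y \<Longrightarrow> z \<in> Z \<Longrightarrow> norm y \<le> K * norm (y + z)"
    using direct_sum_decomposition_bound[OF assms] by blast
  obtain p where p: "\<And>x. p x \<in> Y" "\<And>x. x - p x \<in> Z"
    using sum by (metis add_diff_cancel_left')
  have unique: "p x = y" if "y \<in> Y" "x - y \<in> Z" for x y
  proof -
    have "p x - y \<in> Y"
      by (intro subspace_diff Y p that)
    moreover have "(x - y) - (x - p x) \<in> Z"
      by (intro subspace_diff Z p that)
    ultimately have "p x - y \<in> Y \<inter> Z"
      by simp
    then show ?thesis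
      by (simp add: Int)
  qed
  have "bounded_linear p"
  proof (rule bounded_linear_intro)
    show "p (x + y) = p x + p y" for x y
      using subspace_add[OF Z p(2)[of x] p(2)[of y]]
      by (intro unique subspace_add[OF Y] p) (simp add: algebra_simps)
    show "p (c *\<^sub>R x) = c *\<^sub>R p x" for c x
      using subspace_scale[OF Z p(2)[of x], of c]
      by (intro unique subspace_scale[OF Y] p) (simp add: algebra_simps)
    show "norm (p x) \<le> norm x * K" for x
      using K[OF p(1) p(2), of x x] by (simp add: mult.commute)
  qed
  moreover have "p (y + z) = y" if "y \<in> Y" "z \<in> Z" for y z
    using unique[of y "y + z"] that by simp
  ultimately show ?thesis
    using p
    by (intro isomorphic_spacesI_bounded_linear[of "\<lambda>x. (p x, x - p x)" "\<lambda>u. fst u + snd u"]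
        bounded_linear_add bounded_linear_fst bounded_linear_snd bounded_linear_Pair
        bounded_linear_sub bounded_linear_ident) auto
qed

text \<open>Primariness speaks of internal sums. The isomorphism carries the two factors, embedded
  as \<open>S \<times> {0}\<close> and \<open>{0} \<times> T\<close>, to such a sum in the
  space.\<close>

lemma primary_space_Times:
  fixes S :: "'c::real_normed_vector set" and T :: "'d::real_normed_vector set"
  assumes "primary_space TYPE('a::banach)"
    and iso: "(UNIV :: 'a set) \<simeq> S \<times> T"
    and S: "subspace S" "closed S" and T: "subspace T" "closed T"
  shows "S \<simeq> (UNIV :: 'a set) \<or> T \<simeq> (UNIV :: 'a set)"
proof -
  have "S \<times> T \<simeq> (UNIV :: 'a set)"
    by (rule isomorphic_spaces_sym[OF iso subspace_UNIV])
  then obtain f :: "'c \<times> 'd \<Rightarrow> 'a" and g where f: "homeomorphism (S \<times> T) UNIV f g"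
    "\<And>x y. x \<in> S \<times> T \<Longrightarrow> y \<in> S \<times> T \<Longrightarrow> f (x + y) = f x + f y"
    "\<And>c x. x \<in> S \<times> T \<Longrightarrow> f (c *\<^sub>R x) = c *\<^sub>R f x"
    by (rule isomorphic_spacesE) blast
  have f0: "f 0 = 0"
    using f(3)[of 0 0] subspace_0[OF S(1)] subspace_0[OF T(1)] by (simp add: zero_prod_def)
  have img: "subspace (f ` R)" "closed (f ` R)" "R \<simeq> f ` R"
    if R: "R \<subseteq> S \<times> T" "subspace R" "closed R" for R
  proof -
    show "subspace (f ` R)"
      unfolding subspace_def
    proof (intro conjI ballI allI)
      show "0 \<in> f ` R"
        using f0 subspace_0[OF R(2)] by (metis imageI)
      fix x assume "x \<in> f ` R"
      then obtain u where u: "u \<in> R" "x = f u"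
        by blast
      show "c *\<^sub>R x \<in> f ` R" for c
        using f(3)[of u c] u subspace_scale[OF R(2)] R(1) by (metis imageI subsetD)
      fix y assume "y \<in> f ` R"
      then obtain v where v: "v \<in> R" "y = f v"
        by blast
      show "x + y \<in> f ` R"
        using f(2)[of u v] u v subspace_add[OF R(2)] R(1) by (metis imageI subsetD)
    qed
    \<comment> \<open>A homeomorphism onto the whole space is a closed map, so images of relatively
      closed sets are closed in the space itself.\<close>
    have "closedin (top_of_set (S \<times> T)) R"
      using R by (intro closed_subset)
    then show "closed (f ` R)"
      using homeomorphism_imp_closed_map[OF f(1)] by simp
    show "R \<simeq> f ` R"
    proof (rule isomorphic_spacesI)
      show "homeomorphism R (f ` R) f g"
        by (rule homeomorphism_of_subsets[OF f(1) R(1)]) auto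
    qed (use f(2,3) R(1) in blast)+
  qed
  have sub: "subspace (S \<times> {0})" "subspace ({0} \<times> T)"
    by (intro subspace_Times S T subspace_single_0)+
  have cl: "closed (S \<times> {0 :: 'd})" "closed ({0 :: 'c} \<times> T)"
    by (intro closed_Times S T closed_singleton)+
  have incl: "S \<times> {0} \<subseteq> S \<times> T" "{0} \<times> T \<subseteq> S \<times> T"
    using subspace_0[OF S(1)] subspace_0[OF T(1)] by auto
  have "direct_sum_decomposition (f ` (S \<times> {0})) (f ` ({0} \<times> T))"
    unfolding direct_sum_decomposition_def
  proof (intro conjI allI img incl sub cl)
    fix x
    have "x \<in> f ` (S \<times> T)"
      using homeomorphism_image1[OF f(1)] by simp
    then obtain s t where st: "s \<in> S" "t \<in> T" "x = f (s, t)"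
      by blast
    then have "x = f (s, 0) + f (0, t)"
      using f(2)[of "(s, 0)" "(0, t)"] incl by auto
    then show "\<exists>y\<in>f ` (S \<times> {0}). \<exists>z\<in>f ` ({0} \<times> T). x = y + z"
      using st(1,2) by (intro bexI[of _ "f (s, 0)"] bexI[of _ "f (0, t)"] imageI) simp_all
  next
    have "inj_on f (S \<times> T)"
      using homeomorphism_apply1[OF f(1)] by (metis inj_on_inverseI)
    then have "f ` (S \<times> {0}) \<inter> f ` ({0} \<times> T) = f ` ((S \<times> {0}) \<inter> ({0} \<times> T))"
      using inj_on_image_Int incl by metis
    also have "(S \<times> {0}) \<inter> ({0} \<times> T) = {0}"
      using subspace_0[OF S(1)] subspace_0[OF T(1)] by (auto simp: zero_prod_def)
    finally show "f ` (S \<times> {0}) \<inter> f ` ({0} \<times> T) = {0}"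
      by (simp add: f0)
  qed
  then have *: "f ` (S \<times> {0}) \<simeq> (UNIV :: 'a set) \<or> f ` ({0} \<times> T) \<simeq> (UNIV :: 'a set)"
    using assms(1) unfolding primary_space_def by blast
  have S': "S \<simeq> f ` (S \<times> {0})"
  proof (rule isomorphic_spaces_trans[OF _ img(3)[OF incl(1) sub(1) cl(1)]])
    show "S \<simeq> S \<times> {0 :: 'd}"
      by (rule isomorphic_spacesI_bounded_linear[of "\<lambda>x. (x, 0)" fst])
        (auto intro: bounded_linear_Pair bounded_linear_fst bounded_linear_ident bounded_linear_zero)
  qed
  have T': "T \<simeq> f ` ({0} \<times> T)"
  proof (rule isomorphic_spaces_trans[OF _ img(3)[OF incl(2) sub(2) cl(2)]])
    show "T \<simeq> {0 :: 'c} \<times> T"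
      by (rule isomorphic_spacesI_bounded_linear[of "\<lambda>x. (0, x)" snd])
        (auto intro: bounded_linear_Pair bounded_linear_snd bounded_linear_ident bounded_linear_zero)
  qed
  show ?thesis
    using * isomorphic_spaces_trans[OF S'] isomorphic_spaces_trans[OF T'] by blast
qed

section \<open>The Schroeder-Bernstein Property for squares and in finite dimension\<close>

text \<open>A decomposition argument in the manner of Pelczynski: either the copy of
  \<open>Y\<close> is already isomorphic to \<open>X\<close>, or its complement is, and then both
  \<open>X\<close> and \<open>Y\<close> are isomorphic to \<open>Y \<times> X\<close>.\<close>

lemma schroeder_bernstein_if_isomorphic_square:
  assumes primary: "primary_space TYPE('a::banach)"
    and square: "(UNIV :: 'a set) \<simeq> (UNIV :: 'a set) \<times> (UNIV :: 'a set)"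
  shows "schroeder_bernstein_property TYPE('a) TYPE('b::banach)"
  unfolding schroeder_bernstein_property_def
proof (intro impI, elim conjE exE)
  note [trans] = isomorphic_spaces_trans
  let ?X = "UNIV :: 'a set" and ?Y = "UNIV :: 'b set"
  fix V :: "'a set" and W :: "'b set"
  assume V: "complemented_subspace V" "?Y \<simeq> V" and W: "complemented_subspace W" "?X \<simeq> W"
  obtain Z where Z: "direct_sum_decomposition V Z"
    using V(1) unfolding complemented_subspace_def by blast
  obtain U where U: "direct_sum_decomposition W U"
    using W(1) unfolding complemented_subspace_def by blast
  have "V \<simeq> ?X \<or> Z \<simeq> ?X"
    using primary Z unfolding primary_space_def by blast
  then show "?Y \<simeq> ?X"
  proof
    assume "V \<simeq> ?X"
    then show ?thesis
      by (rule isomorphic_spaces_trans[OF V(2)])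
  next
    assume "Z \<simeq> ?X"
    have "subspace Z"
      using Z unfolding direct_sum_decomposition_def by blast
    have WX: "W \<simeq> ?X"
      by (rule isomorphic_spaces_sym[OF W(2) subspace_UNIV])
    have XWU: "?X \<times> U \<simeq> W \<times> U"
      by (intro isomorphic_spaces_Times W(2) isomorphic_spaces_refl)
    have WUY: "W \<times> U \<simeq> ?Y"
      by (intro isomorphic_spaces_sym[OF direct_sum_decomposition_isomorphic[OF U]] subspace_UNIV)
    have "?Y \<simeq> W \<times> U"
      by (rule direct_sum_decomposition_isomorphic[OF U])
    also have "W \<times> U \<simeq> ?X \<times> U"
      by (intro isomorphic_spaces_Times WX isomorphic_spaces_refl)
    \<comment> \<open>Splitting the factor \<open>X\<close> in two lets one copy recombine with
      \<open>U\<close> to \<open>Y\<close>, while the other stays free to be absorbed with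
      \<open>Z\<close>.\<close>
    also have "?X \<times> U \<simeq> (?X \<times> ?X) \<times> U"
      by (intro isomorphic_spaces_Times square isomorphic_spaces_refl)
    also have "(?X \<times> ?X) \<times> U \<simeq> ?X \<times> ?X \<times> U"
      by (rule isomorphic_spaces_Times_assoc)
    also have "?X \<times> ?X \<times> U \<simeq> ?X \<times> ?Y"
      by (intro isomorphic_spaces_Times isomorphic_spaces_trans[OF XWU WUY] isomorphic_spaces_refl)
    also have "?X \<times> ?Y \<simeq> ?Y \<times> ?X"
      by (rule isomorphic_spaces_Times_commute)
    also have "?Y \<times> ?X \<simeq> V \<times> Z"
      by (intro isomorphic_spaces_Times V(2) isomorphic_spaces_sym[OF \<open>Z \<simeq> ?X\<close> \<open>subspace Z\<close>])
    also have "V \<times> Z \<simeq> ?X"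
      by (intro isomorphic_spaces_sym[OF direct_sum_decomposition_isomorphic[OF Z]] subspace_UNIV)
    finally show ?thesis .
  qed
qed

text \<open>The composition of the embeddings \<open>X\<close> into \<open>Y\<close> into
  \<open>X\<close> is an injective endomorphism, hence surjective in finite dimension, so the copy
  of \<open>Y\<close> fills \<open>X\<close>.\<close>

lemma schroeder_bernstein_if_finite_dimensional:
  assumes "finite B" and B: "span B = (UNIV :: 'a::banach set)"
  shows "schroeder_bernstein_property TYPE('a) TYPE('b::banach)"
  unfolding schroeder_bernstein_property_def
proof (intro impI, elim conjE exE)
  let ?X = "UNIV :: 'a set" and ?Y = "UNIV :: 'b set"
  fix V :: "'a set" and W :: "'b set"
  assume V: "?Y \<simeq> V" and W: "?X \<simeq> W"
  obtain f f' where f: "homeomorphism ?Y V f f'"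
    "\<And>x y. f (x + y) = f x + f y" "\<And>c x. f (c *\<^sub>R x) = c *\<^sub>R f x"
    using isomorphic_spacesE[OF V] by (metis UNIV_I)
  obtain h h' where h: "homeomorphism ?X W h h'"
    "\<And>x y. h (x + y) = h x + h y" "\<And>c x. h (c *\<^sub>R x) = c *\<^sub>R h x"
    using isomorphic_spacesE[OF W] by (metis UNIV_I)
  obtain C where C: "C \<subseteq> B" "independent C" "span C = ?X"
    using B maximal_independent_subset[of B] by (metis span_span span_superset span_mono top.extremum_unique subset_antisym)
  interpret fd: finite_dimensional_vector_space "scaleR :: real \<Rightarrow> 'a \<Rightarrow> 'a" C
    using C \<open>finite B\<close> finite_subset
    by unfold_locales (auto simp: dependent_raw_def[symmetric] span_raw_def[symmetric])
  have "linear (f \<circ> h)"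
    by (intro linearI) (simp_all add: f h)
  moreover have "inj (f \<circ> h)"
    using homeomorphism_apply1[OF f(1)] homeomorphism_apply1[OF h(1)]
    by (intro inj_compose inj_on_inverseI[of _ f'] inj_on_inverseI[of _ h']) auto
  ultimately have "surj (f \<circ> h)"
    by (intro fd.linear_inj_imp_surj) (simp_all add: linear_def)
  then have "V = ?X"
    using homeomorphism_image1[OF f(1)] by (auto simp: surj_def)
  with V show "?Y \<simeq> ?X"
    by simp
qed

text \<open>This will show that no single component is isomorphic to an infinite-dimensional
  space.\<close>

lemma finite_dimensional_if_isomorphic_range:
  fixes p :: "'a::banach \<Rightarrow> 'a"
  assumes "linear p" "finite B" "range p \<subseteq> span B" "range p \<simeq> (UNIV :: 'a set)"
  obtains D :: "'a set" where "finite D" "span D = UNIV"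
proof -
  obtain f and g :: "'a \<Rightarrow> 'a" where f: "homeomorphism (range p) UNIV f g"
    "\<And>x y. x \<in> range p \<Longrightarrow> y \<in> range p \<Longrightarrow> f (x + y) = f x + f y"
    "\<And>c x. x \<in> range p \<Longrightarrow> f (c *\<^sub>R x) = c *\<^sub>R f x"
    using isomorphic_spacesE[OF assms(4)] by metis
  have sub: "subspace (range p)"
    by (intro linear_subspace_image assms subspace_UNIV)
  obtain C where C: "C \<subseteq> range p" "independent C" "range p \<subseteq> span C"
    using maximal_independent_subset by blast
  have "finite C"
    using independent_span_bound[OF assms(2) C(2)] C(1) assms(3) by auto
  \<comment> \<open>The basis is lifted through \<open>p\<close> because \<open>f\<close> is linear
    only on the range, whereas \<open>f \<circ> p\<close> is linear everywhere.\<close>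
  obtain D where D: "p ` D = C" "finite D"
    using finite_subset_image[OF \<open>finite C\<close> C(1)] by metis
  have "linear (f \<circ> p)"
    by (intro linearI) (simp_all add: f linear_add[OF assms(1)] linear_cmul[OF assms(1)])
  then have "span ((f \<circ> p) ` D) = (f \<circ> p) ` span D"
    by (rule linear_span_image)
  also have "\<dots> = f ` span C"
    by (simp only: image_comp[symmetric] linear_span_image[OF assms(1), symmetric] D(1))
  also have "span C = range p"
    using C(1,3) span_minimal[OF _ sub] by blast
  also have "f ` range p = UNIV"
    by (rule homeomorphism_image1[OF f(1)])
  finally show ?thesis
    using that D(2) by blast
qed

section \<open>The projections of an unconditional decomposition\<close>

text \<open>Finite rational combinations are countable, and the closure of their set is a subspace
  because reals are limits of rationals.\<close>

lemma exists_dense_sequence: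
  fixes B :: "'a::real_normed_vector set"
  assumes "countable B"
  obtains q :: "nat \<Rightarrow> 'a" where "span B \<subseteq> closure (range q)"
proof -
  \<comment> \<open>Inserting 0 provides a nonempty set to enumerate even when \<open>B\<close> is
    empty.\<close>
  define b where "b = from_nat_into (insert 0 B)"
  define comb where "comb l = (\<Sum>(r, i)\<leftarrow>l. real_of_rat r *\<^sub>R b i)" for l
  have range_b: "range b = insert 0 B"
    unfolding b_def using assms by (intro range_from_nat_into) auto
  have comb_append: "comb (l @ l') = comb l + comb l'" for l l'
    by (simp add: comb_def)
  have comb_scale: "comb (map (map_prod ((*) r) id) l) = real_of_rat r *\<^sub>R comb l" for r l
    by (induction l) (auto simp: comb_def of_rat_mult scaleR_add_right)
  have "subspace (closure (range comb))"
    unfolding subspace_def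
  proof (intro conjI ballI allI)
    have "comb [] = 0"
      by (simp add: comb_def)
    then show "0 \<in> closure (range comb)"
      using closure_subset by (metis rangeI subsetD)
  next
    fix x y assume "x \<in> closure (range comb)" "y \<in> closure (range comb)"
    then obtain l l' where "\<And>n. l n \<in> range comb" "l \<longlonglongrightarrow> x" "\<And>n. l' n \<in> range comb" "l' \<longlonglongrightarrow> y"
      unfolding closure_sequential by metis
    moreover from this have "l n + l' n \<in> range comb" for n
      using comb_append by (metis imageE rangeI)
    ultimately show "x + y \<in> closure (range comb)"
      unfolding closure_sequential by (intro exI[of _ "\<lambda>n. l n + l' n"]) (auto intro: tendsto_add)
  next
    fix c x assume "x \<in> closure (range comb)"
    then obtain l where l: "\<And>n. l n \<in> range comb" "l \<longlonglongrightarrow> x"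
      unfolding closure_sequential by metis
    have "\<exists>r. \<bar>real_of_rat r - c\<bar> < 1 / Suc n" for n
    proof -
      obtain r where "c - 1 / Suc n < real_of_rat r" "real_of_rat r < c + 1 / Suc n"
        using of_rat_dense[of "c - 1 / Suc n" "c + 1 / Suc n"] by auto
      then show ?thesis
        by (intro exI[of _ r]) (simp only: abs_less_iff, linarith)
    qed
    then obtain r where r: "\<And>n. \<bar>real_of_rat (r n) - c\<bar> < 1 / Suc n"
      by metis
    have "(\<lambda>n. real_of_rat (r n) - c) \<longlonglongrightarrow> 0"
      by (rule Lim_null_comparison[OF _ LIMSEQ_Suc[OF lim_1_over_n]])
        (auto simp del: of_nat_Suc intro!: always_eventually less_imp_le[OF r])
    then have "(\<lambda>n. real_of_rat (r n) *\<^sub>R l n) \<longlonglongrightarrow> c *\<^sub>R x"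
      by (rule tendsto_scaleR[OF LIM_zero_cancel l(2)])
    moreover have "real_of_rat (r n) *\<^sub>R l n \<in> range comb" for n
      using l(1)[of n] comb_scale by (metis imageE rangeI)
    ultimately show "c *\<^sub>R x \<in> closure (range comb)"
      unfolding closure_sequential by (intro exI[of _ "\<lambda>n. real_of_rat (r n) *\<^sub>R l n"]) simp
  qed
  moreover have "x \<in> closure (range comb)" if "x \<in> B" for x
  proof -
    have "x \<in> range b"
      using that by (simp add: range_b)
    then obtain i where "x = b i" ..
    then have "comb [(1, i)] = x"
      by (simp add: comb_def)
    then show ?thesis
      using closure_subset by (metis rangeI subsetD)
  qed
  ultimately have "span B \<subseteq> closure (range comb)"
    by (intro span_minimal subsetI)
  moreover have "range (comb \<circ> from_nat) = range comb"
    by (metis fun.set_map surj_from_nat)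
  ultimately show ?thesis
    using that by metis
qed

lemma bounded_linear_if_continuous:
  assumes "linear f" "continuous_on UNIV f"
  shows "bounded_linear f"
proof -
  have "isCont f 0"
    using assms(2) by (simp add: continuous_on_eq_continuous_at)
  then obtain d where d: "d > 0" "\<And>x. norm x < d \<Longrightarrow> norm (f x) < 1"
    unfolding continuous_at_eps_delta dist_norm
    using linear_0[OF assms(1)] by (metis diff_zero zero_less_one)
  show ?thesis
  proof (rule bounded_linear_intro)
    show "norm (f x) \<le> norm x * (2 / d)" for x
    proof (cases "x = 0")
      case False
      define c where "c = d / (2 * norm x)"
      have c: "c > 0" "norm (c *\<^sub>R x) < d"
        using False d(1) by (auto simp: c_def)
      then have "c * norm (f x) < 1"
        using d(2)[OF c(2)] by (simp add: linear_cmul[OF assms(1)])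
      then show ?thesis
        using False d(1) by (simp add: c_def field_simps)
    qed (simp add: linear_0[OF assms(1)])
  qed (simp_all add: linear_add[OF assms(1)] linear_cmul[OF assms(1)])
qed

text \<open>The uniform bound makes evaluation jointly continuous; this is what allows limits in
  products of operators.\<close>

lemma tendsto_linear_family:
  fixes U :: "nat \<Rightarrow> 'a::real_normed_vector \<Rightarrow> 'b::real_normed_vector"
  assumes "\<And>k. linear (U k)" and "\<And>k x. norm (U k x) \<le> c * norm x"
    and "\<And>x. (\<lambda>k. U k x) \<longlonglongrightarrow> V x" and "y \<longlonglongrightarrow> z"
  shows "(\<lambda>k. U k (y k)) \<longlonglongrightarrow> V z"
proof -
  have "(\<lambda>k. U k (y k - z)) \<longlonglongrightarrow> 0"
  proof (rule Lim_null_comparison)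
    have "(\<lambda>k. c * norm (y k - z)) \<longlonglongrightarrow> c * norm (z - z)"
      by (intro tendsto_intros assms(4))
    then show "(\<lambda>k. c * norm (y k - z)) \<longlonglongrightarrow> 0"
      by simp
  qed (use assms(2) in auto)
  then have "(\<lambda>k. U k (y k - z) + U k z) \<longlonglongrightarrow> 0 + V z"
    by (intro tendsto_add assms(3))
  then show ?thesis
    by (simp add: linear_diff[OF assms(1)])
qed

text \<open>The uniform bound transfers the Cauchy property from the dense sequence to every vector
  by a three-term estimate; completeness then gives the pointwise limit.\<close>

lemma strong_limit_exists:
  fixes U :: "nat \<Rightarrow> 'a::real_normed_vector \<Rightarrow> 'b::banach"
  assumes lin: "\<And>k. linear (U k)" and le: "\<And>k x. norm (U k x) \<le> c * norm x"
    and dense: "closure (range q) = UNIV" and Cauchy: "\<And>i. Cauchy (\<lambda>k. U k (q i))"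
  obtains V where "linear V" "\<And>x. norm (V x) \<le> c * norm x" "\<And>x. (\<lambda>k. U k x) \<longlonglongrightarrow> V x"
proof -
  have "Cauchy (\<lambda>k. U k x)" for x
  proof (rule metric_CauchyI)
    fix e :: real assume "0 < e"
    define d where "d = e / (4 * (\<bar>c\<bar> + 1))"
    have d: "0 < d" "\<bar>c\<bar> * d < e / 4"
      using \<open>0 < e\<close> by (auto simp: d_def field_simps)
    have "x \<in> closure (range q)"
      using dense by simp
    then obtain i where i: "norm (x - q i) < d"
      using d(1) unfolding closure_approachable by (auto simp: dist_norm norm_minus_commute)
    obtain M where M: "\<And>j k. j \<ge> M \<Longrightarrow> k \<ge> M \<Longrightarrow> dist (U j (q i)) (U k (q i)) < e / 4"
      using metric_CauchyD[OF Cauchy[of i], of "e / 4"] \<open>0 < e\<close> by auto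
    have near: "dist (U k x) (U k (q i)) < e / 4" for k
    proof -
      have "dist (U k x) (U k (q i)) = norm (U k (x - q i))"
        by (simp add: linear_diff[OF lin] dist_norm)
      also have "\<dots> \<le> \<bar>c\<bar> * norm (x - q i)"
        by (rule order_trans[OF le mult_right_mono]) auto
      also have "\<dots> \<le> \<bar>c\<bar> * d"
        using i by (intro mult_left_mono) auto
      finally show ?thesis
        using d(2) by simp
    qed
    have "dist (U j x) (U k x) < e" if "j \<ge> M" "k \<ge> M" for j k
      using dist_triangle[of "U j x" "U k x" "U j (q i)"]
        dist_triangle[of "U j (q i)" "U k x" "U k (q i)"]
        near[of j] near[of k] M[OF that] dist_commute[of "U k x" "U k (q i)"] \<open>0 < e\<close>
      by linarith
    then show "\<exists>M. \<forall>j\<ge>M. \<forall>k\<ge>M. dist (U j x) (U k x) < e"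
      by blast
  qed
  then obtain V where V: "\<And>x. (\<lambda>k. U k x) \<longlonglongrightarrow> V x"
    unfolding Cauchy_convergent_iff convergent_def by metis
  have "linear V"
  proof (rule linearI)
    show "V (x + y) = V x + V y" for x y
      using tendsto_add[OF V[of x] V[of y]] V[of "x + y"]
      by (simp add: linear_add[OF lin] LIMSEQ_unique)
    show "V (r *\<^sub>R x) = r *\<^sub>R V x" for r x
      using tendsto_scaleR[OF tendsto_const V[of x], of r] V[of "r *\<^sub>R x"]
      by (simp add: linear_cmul[OF lin] LIMSEQ_unique)
  qed
  moreover have "norm (V x) \<le> c * norm x" for x
    using tendsto_norm[OF V] by (rule tendsto_upperbound) (use le in auto)
  ultimately show ?thesis
    using V that by blast
qed

section \<open>The Boolean algebra of component projections\<close>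

locale projection_family =
  fixes P :: "nat set \<Rightarrow> 'a::banach \<Rightarrow> 'a" and C :: real
  assumes linear_P: "linear (P I)"
    and norm_P_le: "norm (P I x) \<le> C * norm x"
    and P_P: "P I (P J x) = P (I \<inter> J) x"
    and P_UNIV: "P UNIV x = x"
    and P_Un: "I \<inter> J = {} \<Longrightarrow> P (I \<union> J) x = P I x + P J x"
    and P_partial: "(\<lambda>n. P {..<n} x) \<longlonglongrightarrow> x"
    and P_finite: "\<exists>B. finite B \<and> range (P {i}) \<subseteq> span B"
begin

lemma bounded_linear_P: "bounded_linear (P I)"
  by (intro bounded_linear_intro[of _ C])
    (simp_all add: linear_add[OF linear_P] linear_cmul[OF linear_P] norm_P_le mult.commute)

lemma P_empty: "P {} x = 0"
  using P_Un[of "{}" "{}" x] by simp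

lemma mem_range_P_iff: "x \<in> range (P I) \<longleftrightarrow> P I x = x"
  by (metis P_P Int_absorb rangeE rangeI)

lemma subspace_range_P: "subspace (range (P I))"
  by (intro linear_subspace_image linear_P subspace_UNIV)

lemma closed_range_P: "closed (range (P I))"
proof -
  have "range (P I) = {x. P I x = x}"
    using mem_range_P_iff by blast
  then show ?thesis
    using closed_Collect_eq[OF linear_continuous_on[OF bounded_linear_P] continuous_on_id] by simp
qed

lemma range_P_UNIV: "range (P UNIV) = UNIV"
  by (simp add: P_UNIV)

lemma range_P_Un:
  assumes "I \<inter> J = {}"
  shows "range (P (I \<union> J)) \<simeq> range (P I) \<times> range (P J)"
proof (rule isomorphic_spacesI_bounded_linear)
  show "bounded_linear (\<lambda>x. (P I x, P J x))"
    by (intro bounded_linear_Pair bounded_linear_P)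
  show "bounded_linear (\<lambda>u :: 'a \<times> 'a. fst u + snd u)"
    by (intro bounded_linear_add bounded_linear_fst bounded_linear_snd)
  have "P (I \<union> J) (P I x + P J y) = P I x + P J y" for x y
    by (simp add: linear_add[OF linear_P] P_P Int_absorb1)
  then show "(\<lambda>u. fst u + snd u) ` (range (P I) \<times> range (P J)) \<subseteq> range (P (I \<union> J))"
    by (auto simp: mem_range_P_iff)
  show "fst (P I x, P J x) + snd (P I x, P J x) = x" if "x \<in> range (P (I \<union> J))" for x
    using that P_Un[OF assms, of x] by (simp add: mem_range_P_iff)
  show "(P I (fst u + snd u), P J (fst u + snd u)) = u" if "u \<in> range (P I) \<times> range (P J)" for u
    using that assms by (auto simp: linear_add[OF linear_P] P_P P_empty Int_commute)
qed auto

text \<open>\<open>P (I k)\<close> and \<open>P L\<close> agree on \<open>P {..<k} x\<close>, so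
  their difference sees only the tail of \<open>x\<close>, which tends to 0, and the bound
  \<open>C\<close> is uniform in the index set.\<close>

lemma tendsto_P:
  assumes "\<And>k. I k \<in> cyl L k"
  shows "(\<lambda>k. P (I k) x) \<longlonglongrightarrow> P L x"
proof (rule LIM_zero_cancel, rule Lim_null_comparison)
  have "norm (P (I k) x - P L x) \<le> 2 * C * norm (x - P {..<k} x)" for k
  proof -
    have "I k \<inter> {..<k} = L \<inter> {..<k}"
      using assms by (auto simp: mem_cyl_iff)
    then have "P (I k) x - P L x = P (I k) (x - P {..<k} x) - P L (x - P {..<k} x)"
      by (simp add: linear_diff[OF linear_P] P_P)
    also have "norm \<dots> \<le> norm (P (I k) (x - P {..<k} x)) + norm (P L (x - P {..<k} x))"
      by (rule norm_triangle_ineq4)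
    also have "\<dots> \<le> 2 * C * norm (x - P {..<k} x)"
      using norm_P_le[of "I k" "x - P {..<k} x"] norm_P_le[of L "x - P {..<k} x"] by simp
    finally show ?thesis .
  qed
  then show "\<forall>\<^sub>F k in sequentially. norm (P (I k) x - P L x) \<le> 2 * C * norm (x - P {..<k} x)"
    by simp
  have "(\<lambda>k. 2 * C * norm (x - P {..<k} x)) \<longlonglongrightarrow> 2 * C * norm (x - x)"
    by (intro tendsto_intros P_partial)
  then show "(\<lambda>k. 2 * C * norm (x - P {..<k} x)) \<longlonglongrightarrow> 0"
    by simp
qed

text \<open>Finitely many vectors span each component, and the partial sums
  \<open>P {..<n} x\<close> approximate \<open>x\<close>.\<close>

lemma separable:
  obtains q :: "nat \<Rightarrow> 'a" where "closure (range q) = UNIV"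
proof -
  obtain B where B: "\<And>i. finite (B i)" "\<And>i. range (P {i}) \<subseteq> span (B i)"
    using P_finite by metis
  obtain q :: "nat \<Rightarrow> 'a" where q: "span (\<Union>i. B i) \<subseteq> closure (range q)"
    by (rule exists_dense_sequence[of "\<Union>i. B i"])
      (use B(1) in \<open>auto intro!: countable_UN intro: countable_finite\<close>)
  have "P {..<n} x \<in> span (\<Union>i. B i)" for n x
  proof (induction n)
    case (Suc n)
    have "P {n} x \<in> span (\<Union>i. B i)"
      using B(2)[of n] span_mono[OF UN_upper[OF UNIV_I], of B n] by (meson rangeI subsetD)
    moreover have "P {..<Suc n} x = P {..<n} x + P {n} x"
      using P_Un[of "{..<n}" "{n}" x] by (simp add: lessThan_Suc)
    ultimately show ?case
      using Suc span_add by metis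
  qed (simp add: P_empty span_0)
  then have "x \<in> closure (range q)" for x
    using q closed_sequentially[OF closed_closure, of "\<lambda>n. P {..<n} x" "range q" x] P_partial by blast
  then show ?thesis
    using that by blast
qed

section \<open>Coding isomorphisms by sequences of digits\<close>

text \<open>Operators on the whole space give witnesses for different \<open>I\<close> a common
  domain, so that limits can be taken; a natural number as norm bound fits into one digit.\<close>

definition inverse_pair :: "nat set \<Rightarrow> nat \<Rightarrow> ('a \<Rightarrow> 'a) \<Rightarrow> ('a \<Rightarrow> 'a) \<Rightarrow> bool" where
  "inverse_pair I n U S \<longleftrightarrow> linear U \<and> linear S \<and>
    (\<forall>x. norm (U x) \<le> real n * norm x) \<and> (\<forall>x. norm (S x) \<le> real n * norm x) \<and>
    (\<forall>x. U (S x) = x) \<and> (\<forall>x. S (U x) = P I x)"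

text \<open>An isomorphism \<open>f\<close> is extended to \<open>f\<close> after
  \<open>P I\<close>, its inverse serving as \<open>S\<close>; conversely \<open>U\<close>
  restricted to the range is inverse to \<open>S\<close>.\<close>

lemma range_P_isomorphic_iff:
  "range (P I) \<simeq> (UNIV :: 'a set) \<longleftrightarrow> (\<exists>n U S. inverse_pair I n U S)"
proof
  assume "range (P I) \<simeq> (UNIV :: 'a set)"
  then obtain f and g :: "'a \<Rightarrow> 'a" where f: "homeomorphism (range (P I)) UNIV f g"
    "\<And>x y. x \<in> range (P I) \<Longrightarrow> y \<in> range (P I) \<Longrightarrow> f (x + y) = f x + f y"
    "\<And>c x. x \<in> range (P I) \<Longrightarrow> f (c *\<^sub>R x) = c *\<^sub>R f x"
    by (rule isomorphic_spacesE) blast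
  have g: "g x \<in> range (P I)" "f (g x) = x" for x
    using f(1) by (auto simp: homeomorphism_def)
  have gf: "g (f x) = x" if "x \<in> range (P I)" for x
    using homeomorphism_apply1[OF f(1) that] .
  have lin_f: "linear (\<lambda>x. f (P I x))"
    by (intro linearI) (simp_all add: linear_add[OF linear_P] linear_cmul[OF linear_P] f)
  have lin_g: "linear g"
  proof (intro linearI)
    show "g (x + y) = g x + g y" for x y
      using gf[OF subspace_add[OF subspace_range_P g(1)[of x] g(1)[of y]]] f(2)[OF g(1) g(1), of x y]
      by (simp add: g(2))
    show "g (c *\<^sub>R x) = c *\<^sub>R g x" for c x
      using gf[OF subspace_scale[OF subspace_range_P g(1)[of x]], of c] f(3)[OF g(1), of c x]
      by (simp add: g(2))
  qed
  have "continuous_on UNIV (\<lambda>x. f (P I x))"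
    by (rule continuous_on_compose2[OF homeomorphism_cont1[OF f(1)] linear_continuous_on[OF bounded_linear_P]]) auto
  then have "bounded_linear (\<lambda>x. f (P I x))"
    by (rule bounded_linear_if_continuous[OF lin_f])
  moreover have "bounded_linear g"
    by (rule bounded_linear_if_continuous[OF lin_g homeomorphism_cont2[OF f(1)]])
  ultimately obtain K K' where K: "\<And>x. norm (f (P I x)) \<le> norm x * K" "\<And>x. norm (g x) \<le> norm x * K'"
    using bounded_linear.bounded by metis
  obtain n where n: "max K K' \<le> real n"
    using real_arch_simple by blast
  have "norm (f (P I x)) \<le> real n * norm x" "norm (g x) \<le> real n * norm x" for x
    using K[of x] n mult_left_mono[of K "real n" "norm x"] mult_left_mono[of K' "real n" "norm x"]
    by (auto simp: mult.commute)
  then have "inverse_pair I n (\<lambda>x. f (P I x)) g"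
    using lin_f lin_g g(2) gf[OF rangeI] g(1)[unfolded mem_range_P_iff]
    by (simp add: inverse_pair_def)
  then show "\<exists>n U S. inverse_pair I n U S"
    by blast
next
  assume "\<exists>n U S. inverse_pair I n U S"
  then obtain n U S where "inverse_pair I n U S"
    by blast
  then have US: "linear U" "linear S" "norm (U x) \<le> real n * norm x"
    "norm (S x) \<le> real n * norm x" "U (S x) = x" "S (U x) = P I x" for x
    unfolding inverse_pair_def by blast+
  show "range (P I) \<simeq> (UNIV :: 'a set)"
  proof (rule isomorphic_spacesI_bounded_linear)
    show "bounded_linear U" "bounded_linear S"
      using US by (auto intro!: bounded_linear_intro[of _ "real n"] simp: linear_add linear_cmul mult.commute)
    have "P I (S x) = S x" for x
      using US(5,6) by metis
    then show "S ` UNIV \<subseteq> range (P I)"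
      by (metis image_subsetI rangeI)
  qed (auto simp: US(5,6) mem_range_P_iff P_P)
qed

text \<open>Closedness of the witness relation: both product identities survive strong limits under
  a common bound, and \<open>P (I k)\<close> converges strongly to \<open>P L\<close>.\<close>

lemma inverse_pair_limit:
  assumes pair: "\<And>k. inverse_pair (I k) n (U k) (S k)" and I: "\<And>k. I k \<in> cyl L k"
    and dense: "closure (range q) = UNIV"
    and Cauchy: "\<And>i. Cauchy (\<lambda>k. U k (q i))" "\<And>i. Cauchy (\<lambda>k. S k (q i))"
  shows "\<exists>V W. inverse_pair L n V W"
proof -
  have US: "linear (U k)" "linear (S k)" "norm (U k x) \<le> real n * norm x"
    "norm (S k x) \<le> real n * norm x" "U k (S k x) = x" "S k (U k x) = P (I k) x" for k x
    using pair[of k] unfolding inverse_pair_def by blast+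
  obtain V where V: "linear V" "\<And>x. norm (V x) \<le> real n * norm x" "\<And>x. (\<lambda>k. U k x) \<longlonglongrightarrow> V x"
    using strong_limit_exists[of U "real n" q, OF US(1,3) dense Cauchy(1)] by metis
  obtain W where W: "linear W" "\<And>x. norm (W x) \<le> real n * norm x" "\<And>x. (\<lambda>k. S k x) \<longlonglongrightarrow> W x"
    using strong_limit_exists[of S "real n" q, OF US(2,4) dense Cauchy(2)] by metis
  have "V (W x) = x" for x
    using tendsto_linear_family[of U "real n" V "\<lambda>k. S k x", OF US(1,3) V(3) W(3)]
    by (simp add: US(5) LIMSEQ_const_iff)
  moreover have "W (V x) = P L x" for x
    using tendsto_linear_family[of S "real n" W "\<lambda>k. U k x", OF US(2,4) W(3) V(3)]
      tendsto_P[OF I, of x] by (simp add: US(6) LIMSEQ_unique)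
  ultimately show ?thesis
    using V W unfolding inverse_pair_def by blast
qed

text \<open>A pair of operators is coded by its norm bound and by approximations, of arbitrary precision, of
  its values on a dense sequence.\<close>

lemma souslin_isomorphic: "souslin {I. range (P I) \<simeq> (UNIV :: 'a set)}"
proof -
  obtain q :: "nat \<Rightarrow> 'a" where dense: "closure (range q) = UNIV"
    by (rule separable)
  \<comment> \<open>The index of an approximation of \<open>x\<close> from the dense sequence;
    taking the least one makes it a function of \<open>x\<close> and the precision.\<close>
  define code where "code x m = (LEAST l. dist (q l) x < 1 / real (Suc m))" for x m
  have code: "dist (q (code x m)) x < 1 / real (Suc m)" for x m
  proof -
    have "x \<in> closure (range q)"
      using dense by simp
    then have "\<exists>l. dist (q l) x < 1 / real (Suc m)"
      unfolding closure_approachable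
      by (metis imageE of_nat_0_less_iff zero_less_Suc zero_less_divide_1_iff)
    then show ?thesis
      unfolding code_def by (rule LeastI_ex)
  qed
  \<comment> \<open>Once the code for precision \<open>m\<close> is constant, all later vectors lie
    near the same \<open>q l\<close>.\<close>
  have code_Cauchy: "Cauchy y" if *: "\<And>m. \<exists>l K. \<forall>k\<ge>K. code (y k) m = l" for y :: "nat \<Rightarrow> 'a"
  proof (rule metric_CauchyI)
    fix e :: real assume "0 < e"
    then obtain m where m: "1 / real (Suc m) < e / 2"
      using nat_approx_posE[of "e / 2"] by auto
    obtain l K where K: "\<And>k. k \<ge> K \<Longrightarrow> code (y k) m = l"
      using * by blast
    have near: "dist (q l) (y k) < e / 2" if "k \<ge> K" for k
      using code[of "y k" m] K[OF that] m by simp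
    show "\<exists>M. \<forall>j\<ge>M. \<forall>k\<ge>M. dist (y j) (y k) < e"
      using dist_triangle_half_r[OF near near] by blast
  qed
  \<comment> \<open>Digit 0 is the norm bound; digit \<open>Suc j\<close>, with \<open>j\<close>
    decoded to \<open>(i, m)\<close>, holds the codes of \<open>U (q i)\<close> and
    \<open>S (q i)\<close> at precision \<open>m\<close>.\<close>
  define digit where "digit j n U S = (case j of 0 \<Rightarrow> n | Suc j \<Rightarrow>
      (case prod_decode j of (i, m) \<Rightarrow> prod_encode (code (U (q i)) m, code (S (q i)) m)))"
    for j n and U S :: "'a \<Rightarrow> 'a"
  define T where "T v = {I. \<exists>n U S. inverse_pair I n U S \<and> (\<forall>j<length v. digit j n U S = v ! j)}"
    for v
  have "I \<in> {I. range (P I) \<simeq> (UNIV :: 'a set)}"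
    if *: "\<forall>k. T (map b [0..<k]) \<inter> cyl I k \<noteq> {}" for I b
  proof -
    \<comment> \<open>Prefixes of length \<open>Suc k\<close> make the digits up to and including
      \<open>k\<close> correct, so the norm bound is right already for \<open>k = 0\<close>.\<close>
    have "\<exists>J n U S. inverse_pair J n U S \<and> J \<in> cyl I (Suc k) \<and> (\<forall>j\<le>k. digit j n U S = b j)" for k
    proof -
      obtain J where "J \<in> T (map b [0..<Suc k])" "J \<in> cyl I (Suc k)"
        using * by blast
      then obtain n U S where "inverse_pair J n U S"
          "\<And>j. j < Suc k \<Longrightarrow> digit j n U S = map b [0..<Suc k] ! j"
        unfolding T_def by auto
      then show ?thesis
        using \<open>J \<in> cyl I (Suc k)\<close> by (metis add_0 diff_zero less_Suc_eq_le nth_map_upt)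
    qed
    then obtain J n U S where JnUS: "\<And>k. inverse_pair (J k) (n k) (U k) (S k)"
        "\<And>k. J k \<in> cyl I (Suc k)" "\<And>k j. j \<le> k \<Longrightarrow> digit j (n k) (U k) (S k) = b j"
      by metis
    have "n k = b 0" for k
      using JnUS(3)[of 0 k] by (simp add: digit_def)
    moreover have "J k \<in> cyl I k" for k
      using JnUS(2)[of k] by (simp add: mem_cyl_iff)
    moreover have codes: "prod_encode (code (U k (q i)) m, code (S k (q i)) m) = b (Suc (prod_encode (i, m)))"
      if "k \<ge> Suc (prod_encode (i, m))" for i m k
      using JnUS(3)[OF that] by (simp add: digit_def)
    have "\<exists>l K. \<forall>k\<ge>K. code (U k (q i)) m = l" "\<exists>l K. \<forall>k\<ge>K. code (S k (q i)) m = l" for i m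
      using codes[of i m] by (metis fst_conv prod_encode_inverse, metis snd_conv prod_encode_inverse)
    then have "Cauchy (\<lambda>k. U k (q i))" "Cauchy (\<lambda>k. S k (q i))" for i
      by (intro code_Cauchy; blast)+
    ultimately show ?thesis
      using inverse_pair_limit[of J "b 0" U S I q] JnUS(1) dense
      by (auto simp: range_P_isomorphic_iff)
  qed
  moreover have "{I. range (P I) \<simeq> (UNIV :: 'a set)} \<subseteq> T []"
    by (auto simp: T_def range_P_isomorphic_iff)
  moreover have "T v \<subseteq> (\<Union>l. T (v @ [l]))" for v
  proof
    fix I assume "I \<in> T v"
    then obtain n U S where "inverse_pair I n U S" "\<forall>j<length v. digit j n U S = v ! j"
      unfolding T_def by blast
    then have "I \<in> T (v @ [digit (length v) n U S])"
      unfolding T_def by (auto simp: nth_append less_Suc_eq)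
    then show "I \<in> (\<Union>l. T (v @ [l]))"
      by blast
  qed
  ultimately show ?thesis
    unfolding souslin_def by (intro exI[of _ T] conjI allI impI) 
qed

section \<open>The space is isomorphic to its square\<close>

lemma isomorphic_square:
  assumes primary: "primary_space TYPE('a)"
    and infinite: "\<And>D :: 'a set. finite D \<Longrightarrow> span D \<noteq> UNIV"
  shows "(UNIV :: 'a set) \<simeq> (UNIV :: 'a set) \<times> (UNIV :: 'a set)"
proof -
  note [trans] = isomorphic_spaces_trans
  let ?X = "UNIV :: 'a set"
  define A where "A = {I. range (P I) \<simeq> ?X}"
  have small: "\<not> range (P {i}) \<simeq> ?X" for i
  proof
    assume "range (P {i}) \<simeq> ?X"
    moreover obtain B where "finite B" "range (P {i}) \<subseteq> span B"
      using P_finite by blast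
    ultimately show False
      using finite_dimensional_if_isomorphic_range[OF linear_P] infinite by metis
  qed
  have sym_A: "?X \<simeq> range (P I)" if "I \<in> A" for I
    using isomorphic_spaces_sym[OF _ subspace_range_P] that by (simp add: A_def)
  \<comment> \<open>Primariness enters here: of two complementary pieces of a copy of the space, one
    is again a copy.\<close>
  have split: "I \<in> A \<or> J \<in> A" if "I \<inter> J = {}" "I \<union> J \<in> A" for I J
  proof -
    have "?X \<simeq> range (P (I \<union> J))"
      by (rule sym_A[OF that(2)])
    also have "\<dots> \<simeq> range (P I) \<times> range (P J)"
      by (rule range_P_Un[OF that(1)])
    finally show ?thesis
      using primary_space_Times[OF primary _ subspace_range_P closed_range_P subspace_range_P closed_range_P]
      unfolding A_def by blast
  qed
  have UNIV_in: "UNIV \<in> A"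
    by (simp add: A_def range_P_UNIV isomorphic_spaces_refl)
  have dichotomy: "I \<in> A \<or> - I \<in> A" for I
    using split[of I "- I"] UNIV_in by simp
  have tail: "insert i I \<in> A \<longleftrightarrow> I \<in> A" if "i \<notin> I" for i I
  proof
    assume "insert i I \<in> A"
    then show "I \<in> A"
      using split[of "{i}" I] small that by (auto simp: A_def)
  next
    assume "I \<in> A"
    have "- {i} \<in> A"
      using dichotomy[of "{i}"] small by (auto simp: A_def)
    \<comment> \<open>The range of \<open>P I\<close> may be exchanged for that of
      \<open>P (- {i})\<close>, another copy of the space, which together with component
      \<open>i\<close> is everything.\<close>
    have "range (P (I \<union> {i})) \<simeq> range (P I) \<times> range (P {i})"
      using that by (intro range_P_Un) simp
    also have "\<dots> \<simeq> ?X \<times> range (P {i})"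
      using \<open>I \<in> A\<close> by (intro isomorphic_spaces_Times isomorphic_spaces_refl) (simp add: A_def)
    also have "\<dots> \<simeq> range (P (- {i})) \<times> range (P {i})"
      by (intro isomorphic_spaces_Times isomorphic_spaces_refl sym_A[OF \<open>- {i} \<in> A\<close>])
    also have "\<dots> \<simeq> range (P (- {i} \<union> {i}))"
      by (rule isomorphic_spaces_sym[OF range_P_Un subspace_range_P]) simp
    also have "range (P (- {i} \<union> {i})) = ?X"
      by (simp add: range_P_UNIV Un_commute)
    finally show "insert i I \<in> A"
      by (simp add: A_def)
  qed
  obtain I where I: "I \<in> A" "- I \<in> A"
    using souslin_contains_complementary_pair[OF souslin_isomorphic[folded A_def] tail dichotomy] by blast
  have "range (P (I \<union> - I)) \<simeq> range (P I) \<times> range (P (- I))"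
    by (intro range_P_Un) simp
  also have "\<dots> \<simeq> ?X \<times> ?X"
    using I by (intro isomorphic_spaces_Times) (simp_all add: A_def)
  finally show ?thesis
    by (simp add: range_P_UNIV)
qed

end

section \<open>From the decomposition to its projections\<close>

text \<open>\<open>P I x\<close> is the sum of the components of \<open>x\<close> in
  \<open>I\<close>; unconditionality supplies convergence and the uniform bound, and the algebraic
  rules follow from uniqueness of expansions and limits.\<close>

lemma UFDD_projection_family:
  fixes E :: "nat \<Rightarrow> 'a::banach set"
  assumes "UFDD E"
  obtains P C where "projection_family (P :: nat set \<Rightarrow> 'a \<Rightarrow> 'a) C"
proof -
  have E: "subspace (E n)" and ex1: "\<exists>!xs. (\<forall>n. xs n \<in> E n) \<and> xs sums x" for n x
    using assms
    by (simp_all add: UFDD_def unconditional_decomposition_def schauder_decomposition_def)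
  obtain co where co: "\<And>x n. co x n \<in> E n" "\<And>x. co x sums x"
    and unique: "\<And>x xs. (\<And>n. xs n \<in> E n) \<Longrightarrow> xs sums x \<Longrightarrow> co x = xs"
  proof
    let ?co = "\<lambda>x. THE xs. (\<forall>n. xs n \<in> E n) \<and> xs sums x"
    show "?co x n \<in> E n" "?co x sums x" for x n
      using theI'[OF ex1[of x]] by auto
    show "?co x = xs" if "\<And>n. xs n \<in> E n" "xs sums x" for x xs
      using the1_equality[OF ex1[of x]] that by blast
  qed
  obtain C where C: "\<And>x I. \<exists>y. (\<lambda>n. if n \<in> I then co x n else 0) sums y \<and> norm y \<le> C * norm x"
    using assms co unfolding UFDD_def unconditional_decomposition_def by metis
  then obtain P where P: "\<And>I x. (\<lambda>n. if n \<in> I then co x n else 0) sums P I x"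
      "\<And>I x. norm (P I x) \<le> C * norm x"
    by metis
  have co_add: "co (x + y) = (\<lambda>n. co x n + co y n)" for x y
    by (intro unique sums_add co subspace_add E)
  have co_scale: "co (c *\<^sub>R x) = (\<lambda>n. c *\<^sub>R co x n)" for c x
    by (intro unique sums_scaleR_right co subspace_scale E)
  have co_P: "co (P I x) = (\<lambda>n. if n \<in> I then co x n else 0)" for I x
    by (intro unique P) (simp add: co subspace_0[OF E])
  have P_finite_sum: "P I x = sum (co x) I" if "finite I" for I x
    using sums_If_finite_set[OF that] P(1) sums_unique2 by blast
  have "projection_family P C"
  proof
    show "P I (x + y) = P I x + P I y" for I x y
    proof (rule sums_unique2[OF P(1)])
      show "(\<lambda>n. if n \<in> I then co (x + y) n else 0) sums (P I x + P I y)"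
        using sums_add[OF P(1)[of I x] P(1)[of I y]] by (rule back_subst[of "\<lambda>f. f sums _"])
          (auto simp: co_add)
    qed
    show "P I (c *\<^sub>R x) = c *\<^sub>R P I x" for I c x
    proof (rule sums_unique2[OF P(1)])
      show "(\<lambda>n. if n \<in> I then co (c *\<^sub>R x) n else 0) sums (c *\<^sub>R P I x)"
        using sums_scaleR_right[OF P(1)[of I x], of c] by (rule back_subst[of "\<lambda>f. f sums _"])
          (auto simp: co_scale)
    qed
    show "norm (P I x) \<le> C * norm x" for I x
      by (rule P)
    show "P I (P J x) = P (I \<inter> J) x" for I J x
    proof (rule sums_unique2[OF P(1)])
      show "(\<lambda>n. if n \<in> I then co (P J x) n else 0) sums P (I \<inter> J) x"
        using P(1)[of "I \<inter> J" x] by (rule back_subst[of "\<lambda>f. f sums _"]) (auto simp: co_P)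
    qed
    show "P UNIV x = x" for x
      using sums_unique2[OF P(1)[of UNIV x]] co(2) by simp
    show "P (I \<union> J) x = P I x + P J x" if "I \<inter> J = {}" for I J x
    proof (rule sums_unique2[OF P(1)])
      show "(\<lambda>n. if n \<in> I \<union> J then co x n else 0) sums (P I x + P J x)"
        using sums_add[OF P(1)[of I x] P(1)[of J x]] by (rule back_subst[of "\<lambda>f. f sums _"])
          (use that in \<open>auto simp: fun_eq_iff\<close>)
    qed
    show "(\<lambda>n. P {..<n} x) \<longlonglongrightarrow> x" for x
      using co(2)[of x] by (simp add: P_finite_sum sums_def)
    show "\<exists>B. finite B \<and> range (P {i}) \<subseteq> span B" for i
    proof -
      obtain B where "finite B" "E i = span B"
        using assms unfolding UFDD_def by blast
      then show ?thesis
        using co(1) by (intro exI[of _ B]) (auto simp: P_finite_sum)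
    qed
  qed
  then show ?thesis
    by (rule that)
qed

theorem proposition2p1:
  assumes "primary_space TYPE('a::banach)"
    and "\<exists>E :: nat \<Rightarrow> 'a set. UFDD E"
  shows "schroeder_bernstein_property TYPE('a) TYPE('b::banach)"
proof (cases "\<exists>D :: 'a set. finite D \<and> span D = UNIV")
  \<comment> \<open>Finite dimension is treated apart, since a nonzero finite-dimensional space is
    not isomorphic to its square.\<close>
  case True
  then show ?thesis
    using schroeder_bernstein_if_finite_dimensional by blast
next
  case False
  obtain P C where "projection_family (P :: nat set \<Rightarrow> 'a \<Rightarrow> 'a) C"
    using assms(2) UFDD_projection_family by blast
  then show ?thesis
    using projection_family.isomorphic_square assms(1) False
      schroeder_bernstein_if_isomorphic_square by blast
qed

end
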